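(* Let $G=(V,E)$ be a graph on $V=\{1,\dots,n\}$ realized as a unit-disk graph by an atom layout $\{r_i\}_{i=1}^n\subset\mathbb R^d$ ($d\in\{2,3\}$) of pairwise distinct points with threshold $R_b>0$: $\|r_i-r_j\|\le R_b$ if $\{i,j\}\in E$ and $\|r_i-r_j\|>R_b$ if $i\ne j$, $\{i,j\}\notin E$. Let $C_6>0$, $\hbar>0$, $\Omega_{\max}>0$, $\delta_{\max}>0$, and consider $$ i\hbar\frac{d}{dt}\psi(t)=\Big(H_0+\frac{\hbar\,\Omega(t)}2\sum_{k=1}^nX_k-\hbar\,\delta(t)\sum_{k=1}^n\hat n_k\Big)\psi(t),\qquad \psi(0)=|0\rangle^{\otimes n}, $$ with controls $\Omega(t)\in[0,\Omega_{\max}]$, $\delta(t)\in[-\delta_{\max},\delta_{\max}]$. Suppose: (H0) for some $\delta_0>0$, $\ \tau^{\max}<\hbar\delta_0$ and $\hbar\delta_0 n+\tau^{\max}<C_6/R_b^6$; (H1) there exists a smooth curve $\gamma=(\Omega,\delta):[0,1]\to[0,\Omega_{\max}]\times[-\delta_{\max},\delta_{\max}]$ with $\gamma(0)=(0,-\delta_0)$, $\gamma(1)=(0,+\delta_0)$ such that $$ \min_{s\in[0,1]}\big(\lambda_1(s)-\lambda_0(s)\big)>0, $$ where $\lambda_0(s)\le\lambda_1(s)\le\cdots$ are the eigenvalues, counted with multiplicity, of $H_\gamma(s)=\frac{\hbar\Omega(s)}2\sum_kX_k-\hbar\delta(s)\sum_k\hat n_k+H_0$. Then for every $\varepsilon>0$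 there exist $T^*>0$ and controls $(\Omega^*,\delta^* )\in L^\infty(0,T^*;\mathbb R^2)$ with $\Omega^*(t)\in[0,\Omega_{\max}]$ and $\delta^*(t)\in[-\delta_{\max},\delta_{\max}]$ for a.e. $t$, such that the corresponding solution satisfies $$ \mathrm{dist}\big(\psi(T^* ),\mathcal H_{\mathrm{MIS}}\big)\le\varepsilon. $$ Consequently, measuring $\psi(T^* )$ in the computational basis yields a maximum independent set of $G$ with probability at least $1-\varepsilon^2$, i.e. $\sum_{\mathbf x\in\mathrm{MIS}(G)}|\langle\mathbf x|\psi(T^* )\rangle|^2\ge1-\varepsilon^2$.
   Context: State space $\mathcal H=(\mathbb C^2)^{\otimes n}$ with computational basis $|\mathbf x\rangle$, $\mathbf x\in\{0,1\}^n$. $X_k$ and $\hat n_k$ act as $\begin{pmatrix}0&1\\1&0\end{pmatrix}$ and $\begin{pmatrix}0&0\\0&1\end{pmatrix}$ on the $k$-th factor, identity elsewhere. $R_{i,j}=\|r_i-r_j\|$ and $H_0=\sum_{i<j}\frac{C_6}{R_{i,j}^6}\hat n_i\hat n_j$. A bitstring $\mathbf x$ encodes the subset $\{i:x_i=1\}$ of $V$; it encodes an independent set if $x_ix_j=0$ for all $\{i,j\}\in E$. $\mathrm{MIS}(G)$ is the set of bitstrings encoding independent sets of maximum cardinality, and $\mathcal H_{\mathrm{MIS}}=\mathrm{span}_{\mathbb C}\{|\mathbf x\rangle:\mathbf x\in\mathrm{MIS}(G)\}$. Tail energy: $\tau(\mathbf x)=\sum_{i<j,\{i,j\}\notin E}\frac{C_6}{R_{i,j}^6}x_ix_j$,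 and $\tau^{\max}=\max\{\tau(\mathbf x):\mathbf x\text{ encodes an independent set}\}$. $\mathrm{dist}$ is the Hilbert-space norm distance to the subspace. *)

theory Defs
  imports "HOL-Analysis.Analysis"
begin

section \<open>Graphs, independent sets and tail energies\<close>

text \<open>
  Vertices and qubits are indexed by a finite linearly ordered type \<open>'n\<close>, playing the role of
  \<open>{1, ..., n}\<close> with \<open>n = CARD('n)\<close>. A bitstring is a function \<open>'n \<Rightarrow> bool\<close>, encoding the vertex
  subset \<open>{i. x i}\<close>; a graph is given by its set of (two-element) edges.
\<close>

definition simple_graph :: "'n set set \<Rightarrow> bool" where
  "simple_graph E \<longleftrightarrow> (\<forall>e\<in>E. card e = 2)"

definition unit_disk_realization ::
  "'n set set \<Rightarrow> ('n \<Rightarrow> 'a::real_normed_vector) \<Rightarrow> real \<Rightarrow> bool" where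
  "unit_disk_realization E r R \<longleftrightarrow> inj r \<and> 0 < R \<and>
     (\<forall>i j. {i, j} \<in> E \<longrightarrow> norm (r i - r j) \<le> R) \<and>
     (\<forall>i j. i \<noteq> j \<and> {i, j} \<notin> E \<longrightarrow> R < norm (r i - r j))"

definition encodes_independent :: "'n set set \<Rightarrow> ('n \<Rightarrow> bool) \<Rightarrow> bool" where
  "encodes_independent E x \<longleftrightarrow> (\<forall>i j. {i, j} \<in> E \<longrightarrow> \<not> (x i \<and> x j))"

definition MIS :: "'n set set \<Rightarrow> ('n \<Rightarrow> bool) set" where
  "MIS E = {x. encodes_independent E x \<and>
     (\<forall>y. encodes_independent E y \<longrightarrow> card {i. y i} \<le> card {i. x i})}"

definition vdW :: "real \<Rightarrow> ('n \<Rightarrow> 'a::real_normed_vector) \<Rightarrow> 'n \<Rightarrow> 'n \<Rightarrow> real" where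
  "vdW C6 r i j = C6 / norm (r i - r j) ^ 6"

definition tail_energy ::
  "real \<Rightarrow> ('n::{finite,linorder} \<Rightarrow> 'a::real_normed_vector) \<Rightarrow> 'n set set \<Rightarrow> ('n \<Rightarrow> bool) \<Rightarrow> real" where
  "tail_energy C6 r E x =
     (\<Sum>(i, j) \<in> {(i, j). i < j \<and> {i, j} \<notin> E}. vdW C6 r i j * of_bool (x i) * of_bool (x j))"

definition tail_energy_max ::
  "real \<Rightarrow> ('n::{finite,linorder} \<Rightarrow> 'a::real_normed_vector) \<Rightarrow> 'n set set \<Rightarrow> real" where
  "tail_energy_max C6 r E = Max (tail_energy C6 r E ` {x. encodes_independent E x})"


section \<open>State space and Hamiltonian\<close>

text \<open>
  The \<open>n\<close>-fold tensor power of \<open>\<complex>\<^sup>2\<close> is represented in its computational basis, i.e. by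
  coordinate vectors indexed by bitstrings, with \<open>\<complex>\<^sup>2\<close> itself indexed by \<^typ>\<open>bool\<close>
  (\<^const>\<open>False\<close> for \<open>0\<close>, \<^const>\<open>True\<close> for \<open>1\<close>). The norm of this type is the
  Hilbert space norm, and complex scalars act by \<open>*s\<close>.
\<close>

type_synonym 'n state = "complex ^ ('n \<Rightarrow> bool)"
type_synonym 'n operator = "complex ^ ('n \<Rightarrow> bool) ^ ('n \<Rightarrow> bool)"

definition ket :: "('n::finite \<Rightarrow> bool) \<Rightarrow> 'n state" where
  "ket x = axis x 1"

text \<open>Conjugate-linear in the first argument.\<close>

definition braket :: "complex ^ 'm \<Rightarrow> complex ^ 'm \<Rightarrow> complex" where
  "braket u v = (\<Sum>i\<in>UNIV. cnj (u $ i) * v $ i)"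

text \<open>The operator acting as the matrix \<open>A\<close> on the \<open>k\<close>-th tensor factor and as the identity on
  all others.\<close>

definition on_factor :: "'n::finite \<Rightarrow> complex ^ bool ^ bool \<Rightarrow> 'n operator" where
  "on_factor k A = (\<chi> x y. if \<forall>j. j \<noteq> k \<longrightarrow> x j = y j then A $ x k $ y k else 0)"

definition pauli_X :: "complex ^ bool ^ bool" where
  "pauli_X = (\<chi> a b. if a \<noteq> b then 1 else 0)"

definition number_matrix :: "complex ^ bool ^ bool" where
  "number_matrix = (\<chi> a b. if a \<and> b then 1 else 0)"

abbreviation X_op :: "'n::finite \<Rightarrow> 'n operator" where
  "X_op k \<equiv> on_factor k pauli_X"

abbreviation n_op :: "'n::finite \<Rightarrow> 'n operator" where
  "n_op k \<equiv> on_factor k number_matrix"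

definition H_interaction ::
  "real \<Rightarrow> ('n::{finite,linorder} \<Rightarrow> 'a::real_normed_vector) \<Rightarrow> 'n operator" where
  "H_interaction C6 r = (\<Sum>(i, j) \<in> {(i, j). i < j}. vdW C6 r i j *\<^sub>R (n_op i ** n_op j))"

definition hamiltonian ::
  "real \<Rightarrow> real \<Rightarrow> ('n::{finite,linorder} \<Rightarrow> 'a::real_normed_vector) \<Rightarrow> real \<times> real \<Rightarrow> 'n operator" where
  "hamiltonian hbar C6 r = (\<lambda>(\<Omega>, \<delta>).
     H_interaction C6 r + (hbar * \<Omega> / 2) *\<^sub>R (\<Sum>k\<in>UNIV. X_op k)
       - (hbar * \<delta>) *\<^sub>R (\<Sum>k\<in>UNIV. n_op k))"

definition H_MIS :: "'n::finite set set \<Rightarrow> 'n state set" where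
  "H_MIS E = vec.span (ket ` MIS E)"


section \<open>Ordered eigenvalues\<close>

definition eigenspace :: "complex ^ 'm ^ 'm \<Rightarrow> real \<Rightarrow> (complex ^ 'm) set" where
  "eigenspace A e = {v. A *v v = complex_of_real e *s v}"

text \<open>
  The real eigenvalues in increasing order, each repeated according to the complex dimension of its
  eigenspace. For Hermitian matrices, the only ones considered here, all eigenvalues are real,
  geometric and algebraic multiplicities agree, and the list has full length.
\<close>

definition sorted_eigenvalues :: "complex ^ 'm ^ 'm \<Rightarrow> real list" where
  "sorted_eigenvalues A =
     concat (map (\<lambda>e. replicate (vec.dim (eigenspace A e)) e)
       (sorted_list_of_set {e. \<exists>v\<in>eigenspace A e. v \<noteq> 0}))"

definition spectral_gap :: "complex ^ 'm ^ 'm \<Rightarrow> real" where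
  "spectral_gap A = sorted_eigenvalues A ! 1 - sorted_eigenvalues A ! 0"


section \<open>Controls and trajectories\<close>

text \<open>Infinitely differentiable on \<open>S\<close>, with one-sided derivatives at boundary points of an
  interval \<open>S\<close>; \<open>D k\<close> is the \<open>k\<close>-th derivative.\<close>

definition smooth_curve_on :: "real set \<Rightarrow> (real \<Rightarrow> 'a::real_normed_vector) \<Rightarrow> bool" where
  "smooth_curve_on S f \<longleftrightarrow> (\<exists>D. D 0 = f \<and>
     (\<forall>k. \<forall>s\<in>S. (D k has_vector_derivative D (Suc k) s) (at s within S)))"

definition L_infinity :: "real set \<Rightarrow> (real \<Rightarrow> 'a::euclidean_space) \<Rightarrow> bool" where
  "L_infinity S u \<longleftrightarrow> u \<in> borel_measurable (lebesgue_on S) \<and>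
     (\<exists>C. AE t in lebesgue_on S. norm (u t) \<le> C)"

definition abs_continuous_on :: "real set \<Rightarrow> (real \<Rightarrow> 'a::real_normed_vector) \<Rightarrow> bool" where
  "abs_continuous_on S f \<longleftrightarrow> (\<forall>\<epsilon>>0. \<exists>d>0. \<forall>D. D division_of \<Union>D \<and> \<Union>D \<subseteq> S \<and>
     (\<Sum>I\<in>D. Sup I - Inf I) < d \<longrightarrow> (\<Sum>I\<in>D. norm (f (Sup I) - f (Inf I))) < \<epsilon>)"

text \<open>
  Since the controls are merely essentially bounded, solutions of the Schroedinger equation are
  understood in the sense of Caratheodory: absolutely continuous, satisfying the equation almost
  everywhere.
\<close>

definition schroedinger_solution ::
  "real \<Rightarrow> real \<Rightarrow> ('n::{finite,linorder} \<Rightarrow> 'a::real_normed_vector) \<Rightarrow> real \<Rightarrow>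
   (real \<Rightarrow> real \<times> real) \<Rightarrow> (real \<Rightarrow> 'n state) \<Rightarrow> bool" where
  "schroedinger_solution hbar C6 r T u \<psi> \<longleftrightarrow>
     abs_continuous_on {0..T} \<psi> \<and> \<psi> 0 = ket (\<lambda>_. False) \<and>
     (AE t in lebesgue_on {0..T}. \<exists>v. (\<psi> has_vector_derivative v) (at t within {0..T}) \<and>
        (\<i> * complex_of_real hbar) *s v = hamiltonian hbar C6 r (u t) *v \<psi> t)"

end

theory Submission
  imports Defs
begin

text \<open>
  Instead of following the curve slowly, the control is piecewise constant: it takes the values
  \<open>\<gamma> (k / N)\<close> in turn. By the gap and the Lipschitz continuity of \<open>\<gamma>\<close>, consecutive ground states
  have squared overlap at least \<open>1 - O(1 / N\<^sup>2)\<close>. While one Hamiltonian is held, the phase of the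
  excited part rotates relative to that of the ground part with frequencies bounded away from
  \<open>0\<close>, so the interference of the two in the overlap with the next ground state averages out,
  and for a suitable hold time it costs at most \<open>1 / N\<^sup>2\<close>. After \<open>N\<close> steps the squared overlap with
  the last ground state is \<open>1 - O(1 / N)\<close>. At both ends of the curve the Hamiltonian is diagonal,
  and its ground states are the empty bitstring and a maximum independent set.
\<close>

text \<open>The bound depends on losses adding up as squares. Consecutive ground states differ by an
  angle O(1/N). With uncontrolled interference these N angles could add up to an error of order 1,
  however large N is. Once each cross term is bounded below by -1/N^2, only squared angles
  accumulate, and N * O(1/N^2) tends to 0. The price is that the hold times come from a mean value
  argument, depend on the current state, and carry no explicit bound on the total time. Only squared
  moduli of overlaps occur, so the ground states can be chosen point by point with arbitrary phases;
  no continuous choice along the curve is made. The gap also acts at the two ends: it makes the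
  ground state of a diagonal Hamiltonian unique up to a phase, hence a basis vector, and comparing
  energies of bitstrings then identifies it. The claim concerns every Caratheodory solution, so
  uniqueness has to hold among absolutely continuous curves. It rests on the fact that an absolutely
  continuous function with derivative 0 almost everywhere is constant.\<close>

section \<open>Self-adjoint maps and their unitary flows\<close>

text \<open>A minimiser of the Rayleigh quotient on the unit sphere of \<open>W\<close> is an
  eigenvector, because its residual lies in \<open>W\<close> and would otherwise be a direction of
  descent. Allowing an invariant subspace \<open>W\<close> makes the result reusable on orthogonal
  complements.\<close>

lemma selfadjoint_min_eigenvector:
  fixes f :: "'a::euclidean_space \<Rightarrow> 'a"
  assumes lin: "linear f" and sa: "\<And>x y. f x \<bullet> y = x \<bullet> f y"
    and W: "subspace W" "f ` W \<subseteq> W" "W \<noteq> {0}"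
  obtains w \<mu> where "w \<in> W" "norm w = 1" "f w = \<mu> *\<^sub>R w"
    "\<And>v. v \<in> W \<Longrightarrow> \<mu> * (norm v)\<^sup>2 \<le> v \<bullet> f v"
proof -
  have "0 \<in> W" by (rule subspace_0[OF W(1)])
  then obtain w0 where w0: "w0 \<in> W" "w0 \<noteq> 0" using W(3) by blast
  define S where "S = sphere 0 1 \<inter> W"
  have "compact S"
    unfolding S_def by (intro compact_Int_closed compact_sphere closed_subspace W(1))
  moreover have "(1 / norm w0) *\<^sub>R w0 \<in> S"
    using w0 by (auto simp: S_def intro: subspace_scale[OF W(1)])
  moreover have "continuous_on S (\<lambda>v. v \<bullet> f v)"
    by (intro continuous_intros linear_continuous_on linear_conv_bounded_linear[THEN iffD1] lin)
  ultimately obtain w where w: "w \<in> S" "\<And>v. v \<in> S \<Longrightarrow> w \<bullet> f w \<le> v \<bullet> f v"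
    using continuous_attains_inf[of S "\<lambda>v. v \<bullet> f v"] by blast
  define \<mu> where "\<mu> = w \<bullet> f w"
  have nw: "norm w = 1" and wW: "w \<in> W" using w(1) by (auto simp: S_def)
  have low: "\<mu> * (norm v)\<^sup>2 \<le> v \<bullet> f v" if "v \<in> W" for v
  proof (cases "v = 0")
    case False
    have "(1 / norm v) *\<^sub>R v \<in> S"
      using that False by (auto simp: S_def intro: subspace_scale[OF W(1)])
    from w(2)[OF this] have "\<mu> \<le> (v \<bullet> f v) / (norm v)\<^sup>2"
      by (simp add: \<mu>_def linear_cmul[OF lin] power2_eq_square)
    then show ?thesis using False by (simp add: field_simps)
  qed (simp add: linear_0[OF lin])
  define v where "v = f w - \<mu> *\<^sub>R w"
  have vW: "v \<in> W"
    unfolding v_def using W wW by (intro subspace_diff subspace_scale) auto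
  define q where "q = v \<bullet> f v - \<mu> * (norm v)\<^sup>2"
  define n where "n = (norm v)\<^sup>2"
  have q0: "0 \<le> q" using low[OF vW] by (simp add: q_def)
  have quad: "0 \<le> 2 * t * n + t\<^sup>2 * q" for t
  proof -
    have "w + t *\<^sub>R v \<in> W" by (intro subspace_add subspace_scale W vW wW)
    from low[OF this] have "\<mu> * (norm (w + t *\<^sub>R v))\<^sup>2 \<le> (w + t *\<^sub>R v) \<bullet> f (w + t *\<^sub>R v)" .
    moreover have "(w + t *\<^sub>R v) \<bullet> f (w + t *\<^sub>R v) = \<mu> + 2 * t * (v \<bullet> f w) + t\<^sup>2 * (v \<bullet> f v)"
      using sa[of w v] by (simp add: linear_add[OF lin] linear_cmul[OF lin] inner_add
          inner_commute \<mu>_def algebra_simps power2_eq_square)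
    moreover have "(norm (w + t *\<^sub>R v))\<^sup>2 = 1 + 2 * t * (v \<bullet> w) + t\<^sup>2 * (norm v)\<^sup>2"
      using nw unfolding power2_norm_eq_inner
      by (simp add: norm_eq_1 inner_add inner_commute algebra_simps power2_eq_square)
    moreover have "v \<bullet> f w - \<mu> * (v \<bullet> w) = n"
      by (simp add: n_def power2_norm_eq_inner) (simp add: v_def inner_diff)
    ultimately show ?thesis by (simp add: q_def algebra_simps)
  qed
  have "v = 0"
  proof (rule ccontr)
    assume "v \<noteq> 0"
    then have n: "n > 0" by (simp add: n_def)
    \<comment> \<open>A small negative step along the residual makes the linear term win. The 1 in
      the denominator keeps the step defined when \<open>q\<close> is 0.\<close>
    have "2 * (- n / (q + 1)) * n + (- n / (q + 1))\<^sup>2 * q = - (n\<^sup>2 * (q + 2) / (q + 1)\<^sup>2)"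
    proof -
      have "q + 1 \<noteq> 0" using q0 by simp
      then show ?thesis by (simp add: divide_simps) algebra
    qed
    moreover have "n\<^sup>2 * (q + 2) / (q + 1)\<^sup>2 > 0" using q0 n by simp
    ultimately show False using quad[of "- n / (q + 1)"] by linarith
  qed
  then have "f w = \<mu> *\<^sub>R w" by (simp add: v_def)
  with that wW nw low show thesis by blast
qed

text \<open>The initial values with a global solution form an invariant subspace. Its orthogonal
  complement cannot contain an eigenvector of \<open>f\<close>, since these do have global solutions.\<close>

lemma unitary_flow_exists:
  fixes f J :: "'a::euclidean_space \<Rightarrow> 'a"
  assumes lin: "linear f" and sa: "\<And>x y. f x \<bullet> y = x \<bullet> f y"
    and J: "linear J" "\<And>x. J (J x) = - x" "\<And>x. f (J x) = J (f x)"
  obtains x where "x 0 = v" "\<And>t. (x has_vector_derivative - J (f (x t))) (at t)"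
proof -
  define U where "U = {v. \<exists>x. x 0 = v \<and> (\<forall>t. (x has_vector_derivative - J (f (x t))) (at t))}"
  have "subspace U"
    unfolding subspace_def
  proof (intro conjI ballI allI)
    show "0 \<in> U"
      using J(1) lin by (auto simp: U_def linear_0 intro!: exI[of _ "\<lambda>_. 0"])
    fix a b assume "a \<in> U" "b \<in> U"
    then obtain x y where
      "x 0 = a" "\<And>t. (x has_vector_derivative - J (f (x t))) (at t)"
      "y 0 = b" "\<And>t. (y has_vector_derivative - J (f (y t))) (at t)"
      unfolding U_def by blast
    then show "a + b \<in> U"
      unfolding U_def using J(1) lin
      by (auto simp: linear_add intro!: exI[of _ "\<lambda>t. x t + y t"] derivative_eq_intros)
  next
    fix c a assume "a \<in> U"
    then obtain x where "x 0 = a" "\<And>t. (x has_vector_derivative - J (f (x t))) (at t)"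
      unfolding U_def by blast
    then show "c *\<^sub>R a \<in> U"
      unfolding U_def using J(1) lin
      by (auto simp: linear_cmul intro!: exI[of _ "\<lambda>t. c *\<^sub>R x t"] derivative_eq_intros)
  qed
  have fU: "f a \<in> U" if "a \<in> U" for a
  proof -
    obtain x where x: "x 0 = a" "\<And>t. (x has_vector_derivative - J (f (x t))) (at t)"
      using \<open>a \<in> U\<close> unfolding U_def by blast
    \<comment> \<open>Since \<open>f\<close> commutes with \<open>J\<close>, it maps solutions to
      solutions.\<close>
    have "((\<lambda>t. f (x t)) has_vector_derivative - J (f (f (x t)))) (at t)" for t
      using bounded_linear.has_vector_derivative[OF linear_conv_bounded_linear[THEN iffD1, OF lin] x(2)]
        J(3) lin by (simp add: linear_neg)
    then show ?thesis using x(1) unfolding U_def by auto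
  qed
  have "U\<^sup>\<bottom> = {0}"
  proof (rule ccontr)
    assume ne: "U\<^sup>\<bottom> \<noteq> {0}"
    have inv: "f ` (U\<^sup>\<bottom>) \<subseteq> U\<^sup>\<bottom>"
      unfolding orthogonal_comp_def orthogonal_def using fU by (auto simp flip: sa)
    obtain w \<mu> where w: "w \<in> U\<^sup>\<bottom>" "norm w = 1" "f w = \<mu> *\<^sub>R w"
      using selfadjoint_min_eigenvector[OF lin sa subspace_orthogonal_comp inv ne] by metis
    \<comment> \<open>This is exp(-\<mu> t J) applied to \<open>w\<close>: \<open>f\<close> commutes
      with \<open>J\<close>, so it acts as the scalar \<mu> on both \<open>w\<close> and
      \<open>J w\<close>.\<close>
    define x where "x = (\<lambda>t. cos (\<mu> * t) *\<^sub>R w - sin (\<mu> * t) *\<^sub>R J w)"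
    have "(x has_vector_derivative - J (f (x t))) (at t)" for t
      unfolding x_def using J lin w(3)
      by (auto intro!: derivative_eq_intros
          simp: linear_diff linear_cmul algebra_simps has_real_derivative_iff_has_vector_derivative[symmetric])
    then have "w \<in> U" unfolding U_def by (auto intro!: exI[of _ x] simp: x_def)
    then have "w \<bullet> w = 0"
      using w(1) by (auto simp: orthogonal_comp_def orthogonal_def)
    then show False using w(2) by simp
  qed
  then have "U = UNIV"
    using orthogonal_comp_self[OF \<open>subspace U\<close>] by simp
  then have "v \<in> U" by simp
  with that show thesis unfolding U_def by blast
qed

section \<open>Hermitian matrices with a gapped ground state\<close>

lemma of_real_vector_scale: "complex_of_real c *s v = c *\<^sub>R v"
  by (simp add: vec_eq_iff scaleR_conv_of_real[where 'a = complex])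

lemma braket_add_right: "braket u (v + w) = braket u v + braket u w"
  by (simp add: braket_def algebra_simps sum.distrib)

lemma braket_add_left: "braket (u + v) w = braket u w + braket v w"
  by (simp add: braket_def algebra_simps sum.distrib)

lemma braket_diff_right: "braket u (v - w) = braket u v - braket u w"
  by (simp add: braket_def algebra_simps sum_subtractf)

lemma braket_diff_left: "braket (u - v) w = braket u w - braket v w"
  by (simp add: braket_def algebra_simps sum_subtractf)

lemma braket_scale_right: "braket u (c *s v) = c * braket u v"
  by (simp add: braket_def sum_distrib_left algebra_simps)

lemma braket_scale_left: "braket (c *s u) v = cnj c * braket u v"
  by (simp add: braket_def sum_distrib_left algebra_simps)

lemma cnj_braket: "cnj (braket u v) = braket v u"
  by (simp add: braket_def mult.commute)

lemma braket_zero_right [simp]: "braket u 0 = 0"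
  by (simp add: braket_def)

text \<open>This is the bridge by which real results, such as Cauchy-Schwarz and the minimising
  eigenvector, apply to complex matrices. Conversely, orthogonality for \<open>braket\<close>
  amounts to real orthogonality to a vector and to its multiple by the imaginary unit.\<close>

lemma Re_braket: "Re (braket u v) = u \<bullet> v"
  by (simp add: braket_def inner_vec_def inner_complex_def Re_sum)

lemma braket_self: "braket v v = of_real ((norm v)\<^sup>2)"
proof (rule complex_eqI)
  have "cnj (braket v v) = braket v v" by (rule cnj_braket)
  then show "Im (braket v v) = Im (complex_of_real ((norm v)\<^sup>2))"
    by (simp add: complex_eq_iff)
qed (simp add: Re_braket power2_norm_eq_inner)

lemma norm_vector_scale: "norm (c *s v) = cmod c * norm (v :: complex ^ 'm)"
proof -
  have "braket (c *s v) (c *s v) = of_real ((cmod c * norm v)\<^sup>2)"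
    unfolding braket_scale_left braket_scale_right unfolding braket_self
    using complex_norm_square[of c] by (simp add: power_mult_distrib)
  then have "(norm (c *s v))\<^sup>2 = (cmod c * norm v)\<^sup>2"
    unfolding braket_self of_real_eq_iff .
  then show ?thesis by (simp add: power2_eq_iff_nonneg)
qed

lemma cmod_braket_le: "cmod (braket u v) \<le> norm u * norm v"
proof (cases "braket u v = 0")
  case False
  \<comment> \<open>Rotating by this phase makes the form a nonnegative real, to which the real
    Cauchy-Schwarz inequality applies.\<close>
  define c where "c = cnj (sgn (braket u v))"
  have "c * braket u v = of_real (cmod (braket u v))"
    using False complex_norm_square[of "braket u v"]
    by (simp add: c_def sgn_eq field_simps power2_eq_square)
  then have "cmod (braket u v) = u \<bullet> (c *s v)"
    by (metis Re_braket Re_complex_of_real braket_scale_right)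
  also have "\<dots> \<le> norm u * norm (c *s v)" by (rule norm_cauchy_schwarz)
  finally show ?thesis using False by (simp add: c_def norm_vector_scale norm_sgn)
qed simp

lemma bounded_linear_braket: "bounded_linear (braket u)"
proof (rule bounded_linear_intro[where K = "norm u"])
  show "braket u (r *\<^sub>R v) = r *\<^sub>R braket u v" for r v
    by (simp add: braket_scale_right scaleR_conv_of_real[where 'a = complex]
        flip: of_real_vector_scale)
qed (use cmod_braket_le[of u] in \<open>auto simp: braket_add_right mult.commute\<close>)

lemma bounded_linear_vector_scale: "bounded_linear (\<lambda>v :: complex ^ 'm. c *s v)"
  by (intro bounded_linear_intro[where K = "cmod c"])
    (auto simp: vec.scale_right_distrib norm_vector_scale mult.commute
      scaleR_conv_of_real vec_eq_iff)

lemma bounded_linear_vector_scale_left: "bounded_linear (\<lambda>c. c *s (v :: complex ^ 'm))"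
  by (intro bounded_linear_intro[where K = "norm v"])
    (auto simp: norm_vector_scale vec_eq_iff algebra_simps)

section \<open>Hermitian matrices\<close>

definition hermitian :: "complex ^ 'm ^ 'm \<Rightarrow> bool" where
  "hermitian A \<longleftrightarrow> (\<forall>u v. braket (A *v u) v = braket u (A *v v))"

lemma hermitian_inner: "hermitian A \<Longrightarrow> (A *v u) \<bullet> v = u \<bullet> (A *v v)"
  unfolding hermitian_def by (metis Re_braket)

lemma hermitian_braket: "hermitian A \<Longrightarrow> braket (A *v u) v = braket u (A *v v)"
  unfolding hermitian_def by blast

lemma matrix_vector_mult_zero_matrix: "0 *v (v :: complex ^ 'm) = 0"
  by (simp add: vec_eq_iff matrix_vector_mult_def)

lemma matrix_vector_mult_sum: "(\<Sum>i\<in>I. A i) *v v = (\<Sum>i\<in>I. A i *v (v :: complex ^ 'm))"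
  by (induction I rule: infinite_finite_induct)
    (auto simp: matrix_vector_mult_zero_matrix matrix_vector_mult_add_rdistrib)

lemma scaleR_matrix_vector_mult: "(c *\<^sub>R A) *v v = c *\<^sub>R (A *v (v :: complex ^ 'm))"
  by (simp add: vec_eq_iff matrix_vector_mult_def scaleR_sum_right)

lemma hermitian_add: "hermitian A \<Longrightarrow> hermitian B \<Longrightarrow> hermitian (A + B)"
  by (simp add: hermitian_def matrix_vector_mult_add_rdistrib braket_add_left braket_add_right)

lemma hermitian_diff: "hermitian A \<Longrightarrow> hermitian B \<Longrightarrow> hermitian (A - B)"
  by (simp add: hermitian_def matrix_vector_mult_diff_rdistrib braket_diff_left braket_diff_right)

lemma hermitian_scaleR: "hermitian A \<Longrightarrow> hermitian (c *\<^sub>R A)"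
  by (simp add: hermitian_def scaleR_matrix_vector_mult braket_scale_left braket_scale_right
      flip: of_real_vector_scale)

lemma hermitian_sum: "(\<And>i. i \<in> I \<Longrightarrow> hermitian (A i)) \<Longrightarrow> hermitian (\<Sum>i\<in>I. A i)"
proof (induction I rule: infinite_finite_induct)
  case (insert i I)
  then show ?case by (simp add: hermitian_add)
qed (auto simp: hermitian_def matrix_vector_mult_zero_matrix braket_def)

text \<open>A variational description that replaces the sorted list of eigenvalues. \<open>g\<close>
  only bounds the excitation energy from below, so a single value can serve a whole curve of
  Hamiltonians.\<close>

definition ground_state ::
  "complex ^ 'm ^ 'm \<Rightarrow> real \<Rightarrow> complex ^ 'm \<Rightarrow> real \<Rightarrow> bool" where
  "ground_state A e p g \<longleftrightarrow> norm p = 1 \<and> A *v p = complex_of_real e *s p \<and>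
     (\<forall>w. braket p w = 0 \<longrightarrow> (e + g) * (norm w)\<^sup>2 \<le> w \<bullet> (A *v w))"

text \<open>Eigenvectors of distinct eigenvalues are orthogonal, and a pairwise orthogonal set is
  finite. Finiteness matters because \<open>sorted_list_of_set\<close> returns the empty list on
  infinite sets.\<close>

lemma finite_eigenvalues:
  assumes "hermitian A"
  shows "finite {e. \<exists>v\<in>eigenspace A e. v \<noteq> 0}"
proof -
  define S where "S = {e. \<exists>v\<in>eigenspace A e. v \<noteq> 0}"
  have "\<forall>e\<in>S. \<exists>v. v \<in> eigenspace A e \<and> v \<noteq> 0" unfolding S_def by blast
  then obtain v where v: "\<And>e. e \<in> S \<Longrightarrow> v e \<in> eigenspace A e \<and> v e \<noteq> 0" by metis
  have orth: "orthogonal (v d) (v e)" if "d \<in> S" "e \<in> S" "d \<noteq> e" for d e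
  proof -
    have "(A *v v d) \<bullet> v e = v d \<bullet> (A *v v e)" by (rule hermitian_inner[OF assms])
    then have "(d - e) * (v d \<bullet> v e) = 0"
      using v[OF that(1)] v[OF that(2)]
      by (simp add: eigenspace_def of_real_vector_scale algebra_simps)
    then show ?thesis using that(3) by (simp add: orthogonal_def)
  qed
  have "inj_on v S"
  proof (rule inj_onI, rule ccontr)
    fix d e assume "d \<in> S" "e \<in> S" "v d = v e" "d \<noteq> e"
    then show False using orth[of d e] v[of d] by (simp add: orthogonal_def)
  qed
  moreover have "finite (v ` S)"
    using orth by (intro pairwise_orthogonal_imp_finite) (auto simp: pairwise_def)
  ultimately show ?thesis unfolding S_def[symmetric] by (rule finite_imageD[rotated])
qed

lemma vec_dim_eigenspace_pos:
  assumes "p \<in> eigenspace A e" "p \<noteq> 0"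
  shows "vec.dim (eigenspace A e) > 0"
proof -
  have "vec.dim {p} \<le> vec.dim (eigenspace A e)"
    using assms(1) by (intro vec.dim_subset) auto
  moreover have "vec.dim {p} = 1" using assms(2) by (simp add: vec.dim_singleton)
  ultimately show ?thesis by simp
qed

text \<open>Let \<open>p\<close> minimise the energy and \<open>w\<close> minimise it on the
  complement of \<open>p\<close>, with values \<open>e\<close> and \<mu>. A positive gap means that
  \<open>e\<close> is listed once, so \<mu> differs from \<open>e\<close> and is at least the next
  eigenvalue \<open>d\<close>, which sits at position 1. Hence the complement has energy at least
  \<open>e\<close> plus the gap.\<close>

lemma ground_state_of_spectral_gap:
  fixes A :: "complex ^ 'm ^ 'm"
  assumes herm: "hermitian A" and card: "2 \<le> CARD('m)" and gap: "0 < spectral_gap A"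
  obtains e p where "ground_state A e p (spectral_gap A)"
proof -
  define S where "S = {e. \<exists>v\<in>eigenspace A e. v \<noteq> 0}"
  have fin: "finite S"
    unfolding S_def by (rule finite_eigenvalues[OF herm])
  have lin: "linear ((*v) A)" by simp
  have "UNIV \<noteq> {0 :: complex ^ 'm}"
    by (metis UNIV_not_singleton)
  then obtain p e where p: "norm p = 1" "A *v p = e *\<^sub>R p"
    and low: "\<And>v. e * (norm v)\<^sup>2 \<le> v \<bullet> (A *v v)"
    using selfadjoint_min_eigenvector[OF lin hermitian_inner[OF herm] subspace_UNIV]
    by (metis UNIV_I subset_UNIV)
  have pe: "p \<in> eigenspace A e" "p \<noteq> 0"
    using p by (auto simp: eigenspace_def of_real_vector_scale)
  define W where "W = {w. braket p w = 0}"
  have "subspace W"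
    unfolding W_def subspace_def
    by (auto simp: braket_add_right braket_scale_right simp flip: of_real_vector_scale)
  moreover have "(*v) A ` W \<subseteq> W"
    using p(2)
    by (auto simp: W_def braket_scale_left simp flip: of_real_vector_scale hermitian_braket[OF herm])
  \<comment> \<open>Two real vectors cannot span a space of real dimension at least 4, and a vector
    orthogonal to \<open>p\<close> and \<open>\<i> *s p\<close> is orthogonal to \<open>p\<close>
    for \<open>braket\<close>.\<close>
  moreover have "W \<noteq> {0}"
  proof -
    have "dim {p, \<i> *s p} \<le> card {p, \<i> *s p}"
      by (simp add: dim_le_card')
    also have "\<dots> \<le> 2" by (simp add: card_insert_if)
    also have "\<dots> < DIM(complex ^ 'm)" using card by simp
    finally have "dim {p, \<i> *s p} < DIM(complex ^ 'm)" .
    then obtain x where x: "x \<noteq> 0" "\<And>y. y \<in> span {p, \<i> *s p} \<Longrightarrow> orthogonal x y"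
      by (rule orthogonal_to_subspace_exists) blast
    have "p \<in> span {p, \<i> *s p}" "\<i> *s p \<in> span {p, \<i> *s p}"
      by (simp_all add: real_vector.span_base)
    then have "x \<bullet> p = 0" "x \<bullet> (\<i> *s p) = 0"
      using x(2) by (simp_all add: orthogonal_def)
    then have "Re (braket p x) = 0" "Re (braket (\<i> *s p) x) = 0"
      by (auto simp: Re_braket inner_commute)
    then have "braket p x = 0" by (simp add: braket_scale_left complex_eq_iff)
    with x(1) show ?thesis unfolding W_def by auto
  qed
  ultimately obtain w \<mu> where w: "w \<in> W" "norm w = 1" "A *v w = \<mu> *\<^sub>R w"
    and lowW: "\<And>v. v \<in> W \<Longrightarrow> \<mu> * (norm v)\<^sup>2 \<le> v \<bullet> (A *v v)"
    using selfadjoint_min_eigenvector[OF lin hermitian_inner[OF herm]] by metis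
  have we: "w \<in> eigenspace A \<mu>" "w \<noteq> 0"
    using w by (auto simp: eigenspace_def of_real_vector_scale)
  have min: "e \<le> d" if "d \<in> S" for d
  proof -
    obtain v where v: "A *v v = d *\<^sub>R v" "v \<noteq> 0"
      using \<open>d \<in> S\<close> by (auto simp: S_def eigenspace_def of_real_vector_scale)
    then show ?thesis using low[of v] by (simp add: power2_norm_eq_inner)
  qed
  have eS: "e \<in> S" and \<mu>S: "\<mu> \<in> S" using pe we by (auto simp: S_def)
  define R where "R = sorted_list_of_set (S - {e})"
  define rep where "rep = (\<lambda>d. replicate (vec.dim (eigenspace A d)) d)"
  have "sorted_list_of_set S = e # R"
  proof -
    have "Min S = e" using min eS fin by (intro Min_eqI) auto
    then show ?thesis
      unfolding R_def using sorted_list_of_set_nonempty[OF fin] eS by auto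
  qed
  then have ev: "sorted_eigenvalues A = rep e @ concat (map rep R)"
    unfolding sorted_eigenvalues_def S_def[symmetric] rep_def by simp
  \<comment> \<open>A second copy of \<open>e\<close> would fill positions 0 and 1 and make the gap
    vanish.\<close>
  have dim1: "vec.dim (eigenspace A e) = 1"
  proof (rule ccontr)
    assume "vec.dim (eigenspace A e) \<noteq> 1"
    with vec_dim_eigenspace_pos[OF pe] have "2 \<le> length (rep e)"
      unfolding rep_def by simp
    then have "sorted_eigenvalues A ! 0 = e" "sorted_eigenvalues A ! 1 = e"
      unfolding ev by (auto simp: nth_append rep_def)
    then show False using gap by (simp add: spectral_gap_def)
  qed
  have "\<mu> \<noteq> e"
  proof
    assume "\<mu> = e"
    then have we': "w \<in> eigenspace A e" using we by simp
    have sub: "{p, w} \<subseteq> eigenspace A e" using pe we' by simp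
    have "vec.independent {p, w}"
    proof -
      have "p \<notin> vec.span {w}"
      proof
        assume "p \<in> vec.span {w}"
        then obtain c where "p = c *s w" by (auto simp: vec.span_singleton)
        then have "braket p p = 0" using w(1) by (simp add: W_def braket_scale_right)
        then show False using p(1) by (simp add: braket_self)
      qed
      then show ?thesis using we(2) by (simp add: vec.independent_insert)
    qed
    then have "card {p, w} \<le> vec.dim (eigenspace A e)"
      by (rule vec.independent_card_le_dim[OF sub])
    moreover have "p \<noteq> w" using w(1) p(1) by (auto simp: W_def braket_self)
    ultimately show False using dim1 by simp
  qed
  then have \<mu>R: "\<mu> \<in> set R" unfolding R_def using fin \<mu>S by simp
  then obtain d R' where R: "R = d # R'" by (cases R) auto
  have "sorted R" unfolding R_def by simp
  then have "d \<le> \<mu>" using \<mu>R R by auto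
  have "d \<in> S" using R fin set_sorted_list_of_set[of "S - {e}"] unfolding R_def by auto
  then have "vec.dim (eigenspace A d) > 0"
    using vec_dim_eigenspace_pos unfolding S_def by blast
  then have "sorted_eigenvalues A ! 1 = d" "sorted_eigenvalues A ! 0 = e"
    unfolding ev R by (auto simp: rep_def dim1 nth_append)
  then have "e + spectral_gap A = d" by (simp add: spectral_gap_def)
  with \<open>d \<le> \<mu>\<close> have le: "e + spectral_gap A \<le> \<mu>" by simp
  have "ground_state A e p (spectral_gap A)"
    unfolding ground_state_def
  proof (intro conjI allI impI)
    show "(e + spectral_gap A) * (norm v)\<^sup>2 \<le> v \<bullet> (A *v v)" if "braket p v = 0" for v
    proof -
      have "(e + spectral_gap A) * (norm v)\<^sup>2 \<le> \<mu> * (norm v)\<^sup>2"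
        by (intro mult_right_mono le) simp
      also have "\<dots> \<le> v \<bullet> (A *v v)" using that by (intro lowW) (simp add: W_def)
      finally show ?thesis .
    qed
  qed (use p in \<open>auto simp: of_real_vector_scale\<close>)
  with that show thesis by blast
qed

lemma ground_state_norm: "ground_state A e p g \<Longrightarrow> norm p = 1"
  and ground_state_eigen: "ground_state A e p g \<Longrightarrow> A *v p = complex_of_real e *s p"
  by (auto simp: ground_state_def)

lemma ground_state_gap_mono:
  "ground_state A e p g \<Longrightarrow> g' \<le> g \<Longrightarrow> ground_state A e p g'"
  unfolding ground_state_def
  by (meson add_left_mono mult_right_mono order_trans zero_le_power2)

lemma orthogonal_part:
  assumes "norm p = 1"
  shows "braket p (v - braket p v *s p) = 0"
    and "(norm v)\<^sup>2 = (cmod (braket p v))\<^sup>2 + (norm (v - braket p v *s p))\<^sup>2"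
proof -
  define c where "c = braket p v"
  define w where "w = v - c *s p"
  have orth: "braket p w = 0"
    using assms by (simp add: w_def c_def braket_diff_right braket_scale_right braket_self)
  then show "braket p (v - braket p v *s p) = 0" by (simp add: w_def c_def)
  have "braket w p = 0" using orth cnj_braket[of p w] by simp
  then have "braket (c *s p + w) (c *s p + w) = braket (c *s p) (c *s p) + braket w w"
    using orth
    by (simp add: braket_add_left braket_add_right braket_scale_left braket_scale_right)
  moreover have "v = c *s p + w" by (simp add: w_def)
  ultimately have "of_real ((norm v)\<^sup>2) = complex_of_real ((norm (c *s p))\<^sup>2 + (norm w)\<^sup>2)"
    unfolding braket_self of_real_add by simp
  then show "(norm v)\<^sup>2 = (cmod (braket p v))\<^sup>2 + (norm (v - braket p v *s p))\<^sup>2"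
    unfolding of_real_eq_iff norm_vector_scale using assms by (simp add: w_def c_def)
qed

text \<open>There is no cross term, since \<open>A\<close> maps multiples of \<open>p\<close> to
  multiples of \<open>p\<close>. The energy above \<open>e\<close> therefore controls the squared
  distance to the line of \<open>p\<close>; minimality and uniqueness are special cases.\<close>

lemma ground_state_energy_split:
  assumes herm: "hermitian A" and g: "ground_state A e p g"
  shows "e * (norm v)\<^sup>2 + g * (norm (v - braket p v *s p))\<^sup>2 \<le> v \<bullet> (A *v v)"
proof -
  define w where "w = v - braket p v *s p"
  define u where "u = braket p v *s p"
  have np: "norm p = 1" by (rule ground_state_norm[OF g])
  have orth: "braket p w = 0" unfolding w_def by (rule orthogonal_part[OF np])
  have nv: "(norm v)\<^sup>2 = (norm u)\<^sup>2 + (norm w)\<^sup>2"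
    using orthogonal_part(2)[OF np, of v] np by (simp add: u_def w_def norm_vector_scale)
  have v: "v = u + w" by (simp add: u_def w_def)
  have Au: "A *v u = e *\<^sub>R u"
    using ground_state_eigen[OF g]
    by (simp add: u_def vector_scalar_commute flip: of_real_vector_scale)
  have uw: "u \<bullet> w = 0"
    using orth by (simp add: u_def braket_scale_left flip: Re_braket)
  have "u \<bullet> (A *v w) = 0"
    using uw Au by (simp flip: hermitian_inner[OF herm])
  then have "v \<bullet> (A *v v) = e * (norm u)\<^sup>2 + w \<bullet> (A *v w)"
    using uw Au unfolding v
    by (simp add: matrix_vector_right_distrib inner_add inner_commute power2_norm_eq_inner)
  moreover have "(e + g) * (norm w)\<^sup>2 \<le> w \<bullet> (A *v w)"
    using g orth unfolding ground_state_def by blast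
  ultimately show ?thesis unfolding w_def[symmetric] nv by (simp add: algebra_simps)
qed

lemma ground_state_minimal:
  assumes "hermitian A" "ground_state A e p g" "0 \<le> g"
  shows "e * (norm v)\<^sup>2 \<le> v \<bullet> (A *v v)"
  using ground_state_energy_split[OF assms(1,2), of v] assms(3)
  by (smt (verit) mult_nonneg_nonneg zero_le_power2)

lemma ground_state_unique:
  assumes herm: "hermitian A" and g: "ground_state A e p g" "0 < g"
    and v: "A *v v = complex_of_real e *s v"
  shows "v = braket p v *s p"
proof -
  have "v \<bullet> (A *v v) = e * (norm v)\<^sup>2"
    unfolding v by (simp add: of_real_vector_scale power2_norm_eq_inner)
  then have "g * (norm (v - braket p v *s p))\<^sup>2 \<le> 0"
    using ground_state_energy_split[OF herm g(1), of v] by simp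
  then have "(norm (v - braket p v *s p))\<^sup>2 \<le> 0"
    using g(2) by (simp add: mult_le_0_iff)
  then show ?thesis by simp
qed

text \<open>A sine-theta estimate. The part \<eta> of \<open>p'\<close> orthogonal to
  \<open>p\<close> has excess energy at least \<open>g\<close> times its squared norm, while the two
  eigenvalue equations bound this excess by 2 D times its norm. Dividing bounds the sine of the
  angle, so the squared overlap loses only second order in \<open>D\<close>.\<close>

lemma ground_state_perturbation:
  assumes A: "hermitian A" "ground_state A e p g" and A': "hermitian A'" "ground_state A' e' p' g"
    and g: "0 < g" and D: "\<And>v. norm (A' *v v - A *v v) \<le> D * norm v"
  shows "1 - (2 * D / g)\<^sup>2 \<le> (cmod (braket p p'))\<^sup>2"
proof -
  define \<eta> where "\<eta> = p' - braket p p' *s p"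
  have np: "norm p = 1" "norm p' = 1"
    using ground_state_norm[OF A(2)] ground_state_norm[OF A'(2)] by auto
  have orth: "braket p \<eta> = 0" unfolding \<eta>_def by (rule orthogonal_part[OF np(1)])
  have sum1: "1 = (cmod (braket p p'))\<^sup>2 + (norm \<eta>)\<^sup>2"
    using orthogonal_part(2)[OF np(1), of p'] np by (simp add: \<eta>_def)
  have D0: "0 \<le> D" using order_trans[OF norm_ge_zero D[of p]] np by simp
  have eta1: "norm \<eta> \<le> 1"
    using sum1 by (smt (verit) power2_le_imp_le one_power2 zero_le_power2)
  \<comment> \<open>\<open>p\<close> is the trial vector for \<open>A'\<close>. Only this upper
    bound on \<open>e' - e\<close> enters below.\<close>
  have "e' * (norm p)\<^sup>2 \<le> p \<bullet> (A' *v p)"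
    using ground_state_minimal[OF A'] g by simp
  then have "e' \<le> p \<bullet> (A *v p) + p \<bullet> (A' *v p - A *v p)"
    by (simp add: np inner_diff)
  also have "p \<bullet> (A *v p) = e"
    using np by (simp add: ground_state_eigen[OF A(2)] of_real_vector_scale norm_eq_1)
  also have "p \<bullet> (A' *v p - A *v p) \<le> D"
    using norm_cauchy_schwarz[of p "A' *v p - A *v p"] D[of p] np by simp
  finally have e: "e' - e \<le> D" by simp
  have inner\<eta>: "\<eta> \<bullet> p' = (norm \<eta>)\<^sup>2"
  proof -
    have "\<eta> \<bullet> (braket p p' *s p) = 0"
      using orth cnj_braket[of p \<eta>] by (simp add: braket_scale_right flip: Re_braket)
    moreover have "p' = \<eta> + braket p p' *s p" by (simp add: \<eta>_def)
    ultimately show ?thesis by (metis add.right_neutral inner_add_right power2_norm_eq_inner)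
  qed
  have "\<eta> \<bullet> (A *v \<eta>) - e * (norm \<eta>)\<^sup>2 = \<eta> \<bullet> (A *v p') - e * (norm \<eta>)\<^sup>2"
  proof -
    have "\<eta> \<bullet> (A *v (braket p p' *s p)) = 0"
      using orth cnj_braket[of p \<eta>] ground_state_eigen[OF A(2)]
      by (simp add: vector_scalar_commute braket_scale_right flip: Re_braket)
    moreover have "p' = \<eta> + braket p p' *s p" by (simp add: \<eta>_def)
    ultimately show ?thesis
      by (metis add.right_neutral inner_add_right matrix_vector_right_distrib)
  qed
  also have "\<dots> = - (\<eta> \<bullet> (A' *v p' - A *v p')) + (e' - e) * (norm \<eta>)\<^sup>2"
    using inner\<eta> by (simp add: ground_state_eigen[OF A'(2)] of_real_vector_scale
        inner_diff algebra_simps)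
  also have "\<dots> \<le> D * norm \<eta> + D * norm \<eta>"
  proof (rule add_mono)
    have "- (\<eta> \<bullet> (A' *v p' - A *v p')) \<le> norm \<eta> * norm (A' *v p' - A *v p')"
      using norm_cauchy_schwarz[of "- \<eta>" "A' *v p' - A *v p'"] by simp
    also have "\<dots> \<le> norm \<eta> * D"
      using D[of p'] np by (intro mult_left_mono) auto
    finally show "- (\<eta> \<bullet> (A' *v p' - A *v p')) \<le> D * norm \<eta>" by (simp add: mult.commute)
    have "(e' - e) * (norm \<eta>)\<^sup>2 \<le> D * (norm \<eta>)\<^sup>2"
      using e by (intro mult_right_mono) auto
    \<comment> \<open>Lowering the square to a first power gives both error terms the same factor,
      which can then be divided out.\<close>
    also have "\<dots> \<le> D * norm \<eta>"
      using D0 eta1 by (intro mult_left_mono) (auto simp: power2_eq_square mult_left_le)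
    finally show "(e' - e) * (norm \<eta>)\<^sup>2 \<le> D * norm \<eta>" .
  qed
  finally have up: "\<eta> \<bullet> (A *v \<eta>) - e * (norm \<eta>)\<^sup>2 \<le> 2 * D * norm \<eta>" by simp
  have "(e + g) * (norm \<eta>)\<^sup>2 \<le> \<eta> \<bullet> (A *v \<eta>)"
    using A(2) orth unfolding ground_state_def by blast
  with up have "g * (norm \<eta>)\<^sup>2 \<le> 2 * D * norm \<eta>" by (simp add: algebra_simps)
  then have "norm \<eta> \<le> 2 * D / g"
    using g D0 by (cases "\<eta> = 0") (auto simp: power2_eq_square field_simps)
  then have "(norm \<eta>)\<^sup>2 \<le> (2 * D / g)\<^sup>2" by (intro power_mono) auto
  with sum1 show ?thesis by simp
qed

section \<open>Holding the Hamiltonian constant\<close>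

definition schroedinger_field :: "real \<Rightarrow> complex ^ 'm ^ 'm \<Rightarrow> complex ^ 'm \<Rightarrow> complex ^ 'm" where
  "schroedinger_field hbar A v = (- \<i> / complex_of_real hbar) *s (A *v v)"

lemma schroedinger_field_iff:
  assumes "hbar \<noteq> 0"
  shows "(\<i> * complex_of_real hbar) *s v = A *v w \<longleftrightarrow> v = schroedinger_field hbar A w"
proof -
  have "(\<i> * complex_of_real hbar) * (- \<i> / complex_of_real hbar) = 1"
    "(- \<i> / complex_of_real hbar) * (\<i> * complex_of_real hbar) = 1"
    using assms by simp_all
  then show ?thesis
    unfolding schroedinger_field_def
    by (metis vector_smult_assoc vector_smult_lid)
qed

lemma bounded_linear_schroedinger_field: "bounded_linear (schroedinger_field hbar A)"
  unfolding schroedinger_field_def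
  by (intro bounded_linear_compose[OF bounded_linear_vector_scale]) simp

text \<open>The expectation of a Hermitian matrix is real, so an imaginary multiple of it has no
  real part. This is norm conservation in infinitesimal form.\<close>

lemma inner_schroedinger_field:
  assumes "hermitian A"
  shows "v \<bullet> schroedinger_field hbar A v = 0"
proof -
  have "cnj (braket v (A *v v)) = braket v (A *v v)"
    unfolding cnj_braket by (rule hermitian_braket[OF assms])
  then have "Im (braket v (A *v v)) = 0" by (simp add: complex_eq_iff)
  then have "Re ((- \<i> / complex_of_real hbar) * braket v (A *v v)) = 0"
    by (simp add: Re_divide)
  then show ?thesis
    unfolding schroedinger_field_def Re_braket[symmetric] braket_scale_right .
qed

lemma constant_hamiltonian_flow:
  fixes A :: "complex ^ 'm ^ 'm"
  assumes "hermitian A"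
  obtains x where "x 0 = v" "\<And>t. (x has_vector_derivative schroedinger_field hbar A (x t)) (at t)"
proof -
  define f where "f = (\<lambda>v. (1 / hbar) *\<^sub>R (A *v v))"
  have sa: "f x \<bullet> y = x \<bullet> f y" for x y
    using hermitian_inner[OF assms, of x y] by (simp add: f_def)
  have lin: "linear f" unfolding f_def by (intro linear_compose_scale_right) simp
  have J: "linear (\<lambda>v :: complex ^ 'm. \<i> *s v)"
    using bounded_linear_vector_scale by (rule bounded_linear.linear)
  obtain x where "x 0 = v" "\<And>t. (x has_vector_derivative - (\<i> *s f (x t))) (at t)"
    by (rule unitary_flow_exists[OF lin sa J, of v])
      (auto simp: f_def vector_smult_assoc vector_scalar_commute vec_eq_iff)
  moreover have "- (\<i> *s f u) = schroedinger_field hbar A u" for u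
    by (simp add: f_def schroedinger_field_def vec_eq_iff scaleR_conv_of_real[where 'a = complex])
  ultimately show thesis using that by simp
qed

lemma norm_preserved:
  fixes x :: "real \<Rightarrow> 'a::euclidean_space"
  assumes "\<And>t. (x has_vector_derivative F t) (at t)" "\<And>t. x t \<bullet> F t = 0"
  shows "norm (x t) = norm (x 0)"
proof -
  have "((\<lambda>t. x t \<bullet> x t) has_vector_derivative 0) (at t)" for t
    using bounded_bilinear.has_vector_derivative[OF bounded_bilinear_inner assms(1) assms(1)] assms(2)
    by (simp add: inner_commute)
  then have "x t \<bullet> x t = x 0 \<bullet> x 0"
    using has_vector_derivative_zero_constant[of UNIV "\<lambda>t. x t \<bullet> x t"]
    by (metis UNIV_I convex_UNIV)
  then show ?thesis by (simp add: norm_eq_sqrt_inner)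
qed

text \<open>\<open>A - e\<close> is invertible on the complement of \<open>p\<close>. Adding the
  projection onto \<open>p\<close> gives an injective, hence surjective, map on the whole space. It
  preserves the component along \<open>p\<close>, so for \<open>u\<close> orthogonal to
  \<open>p\<close> the added term vanishes. The solution serves as an antiderivative of the excited
  part of a trajectory.\<close>

lemma ground_state_resolvent:
  fixes A :: "complex ^ 'm ^ 'm"
  assumes herm: "hermitian A" and gs: "ground_state A e p g" and g: "0 < g"
    and u: "braket p u = 0"
  obtains \<xi> where "A *v \<xi> - e *\<^sub>R \<xi> = u"
proof -
  define L where "L = (\<lambda>v. A *v v - e *\<^sub>R v + braket p v *s p)"
  have np: "norm p = 1" by (rule ground_state_norm[OF gs])
  have range: "braket p (A *v v - e *\<^sub>R v) = 0" for v
    by (simp add: braket_diff_right ground_state_eigen[OF gs] braket_scale_left braket_scale_right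
        flip: hermitian_braket[OF herm] of_real_vector_scale)
  then have pL: "braket p (L v) = braket p v" for v
    using np by (simp add: L_def braket_add_right braket_scale_right braket_self)
  have "linear L"
    unfolding L_def
    by (intro linear_compose_add linear_compose_sub linear_compose_scale_right linear_ident
        bounded_linear.linear[OF bounded_linear_compose[OF bounded_linear_vector_scale_left
          bounded_linear_braket]] matrix_vector_mul_linear)
  moreover have "v = 0" if "L v = 0" for v
  proof -
    have "braket p v = 0" using pL[of v] that by simp
    moreover from this that have "A *v v = complex_of_real e *s v"
      by (simp add: L_def of_real_vector_scale)
    ultimately show ?thesis using ground_state_unique[OF herm gs g, of v] by simp
  qed
  ultimately have "surj L"
    by (metis linear_injective_imp_surjective linear_injective_0)
  then obtain \<xi> where \<xi>: "L \<xi> = u" by (metis surjD)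
  then have "braket p \<xi> = 0" using pL[of \<xi>] u by simp
  with \<xi> have "A *v \<xi> - e *\<^sub>R \<xi> = u" by (simp add: L_def)
  with that show thesis .
qed

lemma cmod_add_power2: "(cmod (z + w))\<^sup>2 = (cmod z)\<^sup>2 + (cmod w)\<^sup>2 + 2 * Re (cnj z * w)"
  unfolding cmod_power2 by (simp add: power2_eq_square algebra_simps)

text \<open>In the rotating frame of the ground state \<open>p\<close>, the excited part of the solution is the
  derivative of a bounded curve, so its interference with the ground part averages out in time and
  cannot stay below \<open>-\<kappa>\<close> for ever. Some hold time is therefore at least as good as a
  projective measurement of \<open>p\<close>, up to \<open>\<kappa>\<close>.\<close>

lemma hold_time_exists:
  fixes A :: "complex ^ 'm ^ 'm"
  assumes herm: "hermitian A" and gs: "ground_state A e p g" and g: "0 < g"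
    and hbar: "0 < hbar" and \<kappa>: "0 < \<kappa>"
  obtains x t where "x 0 = \<phi>"
    "\<And>t. (x has_vector_derivative schroedinger_field hbar A (x t)) (at t)"
    "0 < t" "(cmod (braket p p'))\<^sup>2 * (cmod (braket p \<phi>))\<^sup>2 - \<kappa> \<le> (cmod (braket p' (x t)))\<^sup>2"
proof -
  have np: "norm p = 1" by (rule ground_state_norm[OF gs])
  obtain \<xi> where \<xi>: "A *v \<xi> - e *\<^sub>R \<xi> = \<phi> - braket p \<phi> *s p"
    using ground_state_resolvent[OF herm gs g orthogonal_part(1)[OF np]] by blast
  \<comment> \<open>The Hamiltonian in the rotating frame: it annihilates \<open>p\<close>, so the
    ground part stands still.\<close>
  define B where "B = A - e *\<^sub>R mat 1"
  have B: "B *v v = A *v v - e *\<^sub>R v" for v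
    by (simp add: B_def matrix_vector_mult_diff_rdistrib scaleR_matrix_vector_mult)
  have "hermitian (mat 1 :: complex ^ 'm ^ 'm)" by (simp add: hermitian_def)
  then have hB: "hermitian B"
    unfolding B_def by (intro hermitian_diff hermitian_scaleR herm)
  obtain w where w: "w 0 = \<xi>"
    "\<And>t. (w has_vector_derivative schroedinger_field hbar B (w t)) (at t)"
    using constant_hamiltonian_flow[OF hB] by blast
  have nw: "norm (w t) = norm \<xi>" for t
    using norm_preserved[OF w(2) inner_schroedinger_field[OF hB]] w(1) by simp
  define a where "a = braket p \<phi>"
  \<comment> \<open>The trajectory in the rotating frame. Its excited part \<open>B *v w t\<close>
    is the derivative of the bounded curve \<open>(\<i> * hbar) *s w t\<close>; the phase in
    \<open>x\<close> returns to the original frame.\<close>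
  define y where "y = (\<lambda>t. a *s p + B *v w t)"
  define x where "x = (\<lambda>t. cis (- e * t / hbar) *s y t)"
  have "x 0 = \<phi>"
    using \<xi> by (simp add: x_def y_def w(1) B a_def)
  moreover have "(x has_vector_derivative schroedinger_field hbar A (x t)) (at t)" for t
  proof -
    have Bp: "B *v (a *s p) = 0"
      by (simp add: B vector_scalar_commute ground_state_eigen[OF gs] vec_eq_iff
          flip: of_real_vector_scale)
    have "(y has_vector_derivative schroedinger_field hbar B (y t)) (at t)"
    proof -
      have "((\<lambda>t. B *v w t) has_vector_derivative B *v schroedinger_field hbar B (w t)) (at t)"
        by (rule bounded_linear.has_vector_derivative[OF _ w(2)]) simp
      moreover have "B *v schroedinger_field hbar B (w t) = schroedinger_field hbar B (y t)"
        by (simp only: schroedinger_field_def y_def matrix_vector_right_distrib Bp)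
          (simp only: vector_scalar_commute add_0_left)
      ultimately show ?thesis unfolding y_def by (auto intro!: derivative_eq_intros)
    qed
    moreover have "((\<lambda>t. cis (- e * t / hbar)) has_vector_derivative
        (- \<i> * e / hbar) * cis (- e * t / hbar)) (at t)"
    proof -
      have "((\<lambda>z. exp (\<i> * (- e * z / hbar))) has_field_derivative
          (- \<i> * e / hbar) * exp (\<i> * (- e * of_real t / hbar))) (at (of_real t))"
        using hbar by (auto intro!: derivative_eq_intros)
      from has_vector_derivative_real_field[OF this] show ?thesis
        by (simp add: cis_conv_exp)
    qed
    ultimately have "(x has_vector_derivative
        cis (- e * t / hbar) *s schroedinger_field hbar B (y t) +
        ((- \<i> * e / hbar) * cis (- e * t / hbar)) *s y t) (at t)"
      unfolding x_def
      by (intro bounded_bilinear.has_vector_derivative[where prod = "(*s)"])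
        (auto intro!: bounded_bilinear.intro exI[of _ 1]
          simp: vec_eq_iff algebra_simps norm_vector_scale scaleR_conv_of_real[where 'a = complex])
    also have "cis (- e * t / hbar) *s schroedinger_field hbar B (y t) +
        ((- \<i> * e / hbar) * cis (- e * t / hbar)) *s y t = schroedinger_field hbar A (x t)"
      by (simp add: schroedinger_field_def x_def B vector_scalar_commute vec_eq_iff
          scaleR_conv_of_real[where 'a = complex] algebra_simps diff_divide_distrib)
    finally show ?thesis .
  qed
  moreover obtain t where "0 < t"
    "(cmod (braket p p'))\<^sup>2 * (cmod (braket p \<phi>))\<^sup>2 - \<kappa> \<le> (cmod (braket p' (x t)))\<^sup>2"
  proof -
    \<comment> \<open>The amplitude that would remain after projecting onto \<open>p\<close>.
      \<open>G\<close> is an antiderivative of its interference term with the excited part.\<close>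
    define z where "z = a * braket p' p"
    define G where "G = (\<lambda>t. Re (cnj z * braket p' ((\<i> * hbar) *s w t)))"
    have "(G has_real_derivative Re (cnj z * braket p' (B *v w t))) (at t)" for t
    proof -
      have "bounded_linear (\<lambda>v. Re (cnj z * braket p' ((\<i> * hbar) *s v)))"
        by (intro bounded_linear_compose[OF bounded_linear_Re]
            bounded_linear_compose[OF bounded_linear_mult_right]
            bounded_linear_compose[OF bounded_linear_braket] bounded_linear_vector_scale)
      from bounded_linear.has_vector_derivative[OF this w(2)]
      have "(G has_vector_derivative
          Re (cnj z * braket p' ((\<i> * hbar) *s schroedinger_field hbar B (w t)))) (at t)"
        unfolding G_def .
      moreover have "(\<i> * hbar) *s schroedinger_field hbar B (w t) = B *v w t"
        using hbar by (simp add: schroedinger_field_iff)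
      ultimately show ?thesis by (simp add: has_real_derivative_iff_has_vector_derivative)
    qed
    note G = this
    define C where "C = cmod z * (norm p' * (hbar * norm \<xi>))"
    have GC: "\<bar>G t\<bar> \<le> C" for t
    proof -
      have "\<bar>G t\<bar> \<le> cmod z * cmod (braket p' ((\<i> * hbar) *s w t))"
        unfolding G_def using abs_Re_le_cmod by (metis complex_mod_cnj norm_mult)
      also have "\<dots> \<le> cmod z * (norm p' * norm ((\<i> * hbar) *s w t))"
        by (intro mult_left_mono cmod_braket_le) simp
      finally show ?thesis
        using hbar by (simp add: C_def norm_vector_scale norm_mult nw)
    qed
    have C0: "0 \<le> C" using hbar by (simp add: C_def)
    \<comment> \<open>The average of the derivative of \<open>G\<close> over this time is at least
      -2 C / T, which is at least -\<kappa> / 2; the factor 2 in the squared modulus makes this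
      -\<kappa>. The 1 keeps \<open>T\<close> positive when \<open>C\<close> is 0.\<close>
    define T where "T = 4 * (C + 1) / \<kappa>"
    have T: "0 < T" using C0 \<kappa> by (simp add: T_def)
    \<comment> \<open>The mean value theorem supplies a strictly positive time at which the
      interference equals its average.\<close>
    have "\<exists>t>0. t < T \<and> G T - G 0 = (T - 0) * Re (cnj z * braket p' (B *v w t))"
      by (rule MVT2[OF T]) (rule G)
    then obtain t where t: "0 < t" "t < T"
      "G T - G 0 = (T - 0) * Re (cnj z * braket p' (B *v w t))"
      by blast
    have "- (2 * C) \<le> G T - G 0" using GC[of T] GC[of 0] by linarith
    then have "- (2 * C) \<le> T * Re (cnj z * braket p' (B *v w t))" using t(3) by simp
    then have "- (2 * C) / T \<le> Re (cnj z * braket p' (B *v w t))"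
      using T by (simp add: field_simps)
    moreover have "2 * C / T \<le> \<kappa> / 2"
      using T C0 \<kappa> by (simp add: T_def field_simps)
    ultimately have cross: "- \<kappa> \<le> 2 * Re (cnj z * braket p' (B *v w t))" by simp
    have "braket p' (x t) = cis (- e * t / hbar) * (z + braket p' (B *v w t))"
      by (simp add: x_def y_def braket_scale_right braket_add_right z_def distrib_left)
    then have "cmod (braket p' (x t)) = cmod (z + braket p' (B *v w t))"
      by (simp add: norm_mult)
    then have "(cmod (braket p' (x t)))\<^sup>2 = (cmod z)\<^sup>2 + (cmod (braket p' (B *v w t)))\<^sup>2
        + 2 * Re (cnj z * braket p' (B *v w t))"
      by (simp only: cmod_add_power2)
    then have "(cmod z)\<^sup>2 - \<kappa> \<le> (cmod (braket p' (x t)))\<^sup>2"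
      using cross zero_le_power2[of "cmod (braket p' (B *v w t))"] by linarith
    moreover have "cmod (braket p' p) = cmod (braket p p')"
      by (metis cnj_braket complex_mod_cnj)
    ultimately show thesis
      using that[of t] t(1) by (simp add: z_def a_def norm_mult power_mult_distrib mult.commute)
  qed
  ultimately show thesis using that by blast
qed

section \<open>Absolutely continuous solutions\<close>

lemma abs_continuous_on_diff:
  fixes f g :: "real \<Rightarrow> 'a::real_normed_vector"
  assumes f: "abs_continuous_on S f" and g: "abs_continuous_on S g"
  shows "abs_continuous_on S (\<lambda>t. f t - g t)"
  unfolding abs_continuous_on_def
proof (intro allI impI)
  fix \<epsilon> :: real assume \<epsilon>: "\<epsilon> > 0"
  obtain d1 where d1: "d1 > 0" "\<And>D. D division_of \<Union>D \<and> \<Union>D \<subseteq> S \<and> (\<Sum>I\<in>D. Sup I - Inf I) < d1 \<Longrightarrow>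
      (\<Sum>I\<in>D. norm (f (Sup I) - f (Inf I))) < \<epsilon> / 2"
    using f \<epsilon> unfolding abs_continuous_on_def by (meson half_gt_zero)
  obtain d2 where d2: "d2 > 0" "\<And>D. D division_of \<Union>D \<and> \<Union>D \<subseteq> S \<and> (\<Sum>I\<in>D. Sup I - Inf I) < d2 \<Longrightarrow>
      (\<Sum>I\<in>D. norm (g (Sup I) - g (Inf I))) < \<epsilon> / 2"
    using g \<epsilon> unfolding abs_continuous_on_def by (meson half_gt_zero)
  show "\<exists>d>0. \<forall>D. D division_of \<Union>D \<and> \<Union>D \<subseteq> S \<and> (\<Sum>I\<in>D. Sup I - Inf I) < d \<longrightarrow>
      (\<Sum>I\<in>D. norm (f (Sup I) - g (Sup I) - (f (Inf I) - g (Inf I)))) < \<epsilon>"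
  proof (intro exI[of _ "min d1 d2"] conjI allI impI)
    fix D assume D: "D division_of \<Union>D \<and> \<Union>D \<subseteq> S \<and> (\<Sum>I\<in>D. Sup I - Inf I) < min d1 d2"
    have "(\<Sum>I\<in>D. norm (f (Sup I) - g (Sup I) - (f (Inf I) - g (Inf I)))) \<le>
        (\<Sum>I\<in>D. norm (f (Sup I) - f (Inf I)) + norm (g (Sup I) - g (Inf I)))"
    proof (rule sum_mono)
      fix I show "norm (f (Sup I) - g (Sup I) - (f (Inf I) - g (Inf I))) \<le>
          norm (f (Sup I) - f (Inf I)) + norm (g (Sup I) - g (Inf I))"
        using norm_triangle_ineq4[of "f (Sup I) - f (Inf I)" "g (Sup I) - g (Inf I)"]
        by (simp add: algebra_simps)
    qed
    also have "\<dots> < \<epsilon>" using d1(2)[of D] d2(2)[of D] D by (simp add: sum.distrib)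
    finally show "(\<Sum>I\<in>D. norm (f (Sup I) - g (Sup I) - (f (Inf I) - g (Inf I)))) < \<epsilon>" .
  qed (use d1(1) d2(1) in simp)
qed

lemma division_of_real_interval:
  fixes D :: "real set set"
  assumes "D division_of T" "I \<in> D"
  shows "I = {Inf I..Sup I}" "Inf I \<le> Sup I" "Inf I \<in> T" "Sup I \<in> T"
proof -
  obtain a b :: real where I: "I = {a..b}"
    using division_ofD(4)[OF assms] by (auto simp: cbox_interval)
  moreover have "I \<noteq> {}" "I \<subseteq> T" using division_ofD(2,3)[OF assms] by auto
  ultimately show "I = {Inf I..Sup I}" "Inf I \<le> Sup I" "Inf I \<in> T" "Sup I \<in> T" by auto
qed

lemma abs_continuous_on_pair:
  assumes f: "abs_continuous_on S f" and \<epsilon>: "\<epsilon> > 0"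
  obtains d where "d > 0"
    "\<And>u v. u \<le> v \<Longrightarrow> {u..v} \<subseteq> S \<Longrightarrow> v - u < d \<Longrightarrow> norm (f v - f u) < \<epsilon>"
proof -
  obtain d where d: "d > 0" "\<And>D. D division_of \<Union>D \<and> \<Union>D \<subseteq> S \<and> (\<Sum>I\<in>D. Sup I - Inf I) < d \<Longrightarrow>
      (\<Sum>I\<in>D. norm (f (Sup I) - f (Inf I))) < \<epsilon>"
    using f \<epsilon> unfolding abs_continuous_on_def by meson
  have "norm (f v - f u) < \<epsilon>" if "u \<le> v" "{u..v} \<subseteq> S" "v - u < d" for u v
    using d(2)[of "{{u..v}}"] that division_of_self[of u v] by (simp add: cbox_interval)
  with that d(1) show thesis by blast
qed

lemma abs_continuous_on_imp_continuous_on: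
  fixes f :: "real \<Rightarrow> 'a::real_normed_vector"
  assumes f: "abs_continuous_on {a..b} f"
  shows "continuous_on {a..b} f"
  unfolding continuous_on_iff
proof (intro ballI allI impI)
  fix x and \<epsilon> :: real assume x: "x \<in> {a..b}" and \<epsilon>: "0 < \<epsilon>"
  obtain d where d: "d > 0"
    "\<And>u v. u \<le> v \<Longrightarrow> {u..v} \<subseteq> {a..b} \<Longrightarrow> v - u < d \<Longrightarrow> norm (f v - f u) < \<epsilon>"
    using abs_continuous_on_pair[OF f \<epsilon>] by blast
  have "dist (f y) (f x) < \<epsilon>" if "y \<in> {a..b}" "dist y x < d" for y
    using d(2)[of x y] d(2)[of y x] that x
    by (cases "x \<le> y") (auto simp: dist_norm norm_minus_commute)
  with d(1) show "\<exists>d>0. \<forall>x'\<in>{a..b}. dist x' x < d \<longrightarrow> dist (f x') (f x) < \<epsilon>" by blast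
qed

text \<open>A continuous \<open>f\<close> is bounded on a compact interval, so a difference of
  squares is at most a constant times the difference. It will be applied to the difference of two
  solutions.\<close>

lemma abs_continuous_on_norm_power2:
  fixes f :: "real \<Rightarrow> 'a::real_normed_vector"
  assumes f: "abs_continuous_on {a..b} f"
  shows "abs_continuous_on {a..b} (\<lambda>t. (norm (f t))\<^sup>2)"
proof -
  have "bounded (f ` {a..b})"
    using abs_continuous_on_imp_continuous_on[OF f]
    by (intro compact_imp_bounded compact_continuous_image) auto
  then obtain M where M: "M > 0" "\<And>t. t \<in> {a..b} \<Longrightarrow> norm (f t) \<le> M"
    by (auto simp: bounded_pos)
  show ?thesis
    unfolding abs_continuous_on_def
  proof (intro allI impI)
    fix \<epsilon> :: real assume "\<epsilon> > 0"
    then have "\<epsilon> / (2 * M) > 0" using M(1) by simp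
    then obtain d where d: "d > 0"
      "\<And>D. D division_of \<Union>D \<and> \<Union>D \<subseteq> {a..b} \<and> (\<Sum>I\<in>D. Sup I - Inf I) < d \<Longrightarrow>
        (\<Sum>I\<in>D. norm (f (Sup I) - f (Inf I))) < \<epsilon> / (2 * M)"
      using f unfolding abs_continuous_on_def by meson
    show "\<exists>d>0. \<forall>D. D division_of \<Union>D \<and> \<Union>D \<subseteq> {a..b} \<and> (\<Sum>I\<in>D. Sup I - Inf I) < d \<longrightarrow>
        (\<Sum>I\<in>D. norm ((norm (f (Sup I)))\<^sup>2 - (norm (f (Inf I)))\<^sup>2)) < \<epsilon>"
    proof (intro exI[of _ d] conjI allI impI d(1))
      fix D assume D: "D division_of \<Union>D \<and> \<Union>D \<subseteq> {a..b} \<and> (\<Sum>I\<in>D. Sup I - Inf I) < d"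
      have "(\<Sum>I\<in>D. norm ((norm (f (Sup I)))\<^sup>2 - (norm (f (Inf I)))\<^sup>2)) \<le>
          (\<Sum>I\<in>D. 2 * M * norm (f (Sup I) - f (Inf I)))"
      proof (rule sum_mono)
        fix I assume "I \<in> D"
        then have "Inf I \<in> {a..b}" "Sup I \<in> {a..b}"
          using D division_of_real_interval(3,4)[of D "\<Union>D" I] by blast+
        then have M': "norm (f (Inf I)) \<le> M" "norm (f (Sup I)) \<le> M" using M(2) by auto
        have "norm ((norm (f (Sup I)))\<^sup>2 - (norm (f (Inf I)))\<^sup>2) =
            (norm (f (Sup I)) + norm (f (Inf I))) * \<bar>norm (f (Sup I)) - norm (f (Inf I))\<bar>"
          by (simp add: square_diff_square_factored power2_eq_square abs_mult)
        also have "\<dots> \<le> (2 * M) * norm (f (Sup I) - f (Inf I))"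
          using M' M(1) by (intro mult_mono norm_triangle_ineq3) auto
        finally show "norm ((norm (f (Sup I)))\<^sup>2 - (norm (f (Inf I)))\<^sup>2) \<le>
            2 * M * norm (f (Sup I) - f (Inf I))" .
      qed
      also have "\<dots> = 2 * M * (\<Sum>I\<in>D. norm (f (Sup I) - f (Inf I)))"
        by (simp add: sum_distrib_left)
      also have "\<dots> < 2 * M * (\<epsilon> / (2 * M))"
        using d(2)[OF D] M(1) by (intro mult_strict_left_mono) auto
      finally show "(\<Sum>I\<in>D. norm ((norm (f (Sup I)))\<^sup>2 - (norm (f (Inf I)))\<^sup>2)) < \<epsilon>"
        using M(1) by simp
    qed
  qed
qed

lemma lipschitz_on_imp_abs_continuous_on:
  fixes f :: "real \<Rightarrow> 'a::real_normed_vector"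
  assumes f: "L-lipschitz_on S f"
  shows "abs_continuous_on S f"
  unfolding abs_continuous_on_def
proof (intro allI impI)
  fix \<epsilon> :: real assume \<epsilon>: "\<epsilon> > 0"
  have L: "0 \<le> L" by (rule lipschitz_on_nonneg[OF f])
  show "\<exists>d>0. \<forall>D. D division_of \<Union>D \<and> \<Union>D \<subseteq> S \<and> (\<Sum>I\<in>D. Sup I - Inf I) < d \<longrightarrow>
      (\<Sum>I\<in>D. norm (f (Sup I) - f (Inf I))) < \<epsilon>"
  proof (intro exI[of _ "\<epsilon> / (L + 1)"] conjI allI impI)
    fix D assume D: "D division_of \<Union>D \<and> \<Union>D \<subseteq> S \<and> (\<Sum>I\<in>D. Sup I - Inf I) < \<epsilon> / (L + 1)"
    have "(\<Sum>I\<in>D. norm (f (Sup I) - f (Inf I))) \<le> (\<Sum>I\<in>D. L * (Sup I - Inf I))"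
    proof (rule sum_mono)
      fix I assume "I \<in> D"
      then have "Inf I \<le> Sup I" "Inf I \<in> S" "Sup I \<in> S"
        using D division_of_real_interval(2-4)[of D "\<Union>D" I] by blast+
      then show "norm (f (Sup I) - f (Inf I)) \<le> L * (Sup I - Inf I)"
        using lipschitz_onD[OF f, of "Sup I" "Inf I"] by (simp add: dist_norm)
    qed
    also have "\<dots> = L * (\<Sum>I\<in>D. Sup I - Inf I)" by (simp add: sum_distrib_left)
    also have "\<dots> \<le> L * (\<epsilon> / (L + 1))" using D L by (intro mult_left_mono) auto
    also have "\<dots> < \<epsilon>" using L \<epsilon> by (simp add: field_simps)
    finally show "(\<Sum>I\<in>D. norm (f (Sup I) - f (Inf I))) < \<epsilon>" .
  qed (use L \<epsilon> in simp)
qed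

lemma tagged_division_subset_division_of:
  assumes p: "p tagged_division_of S" and q: "q \<subseteq> p"
  shows "snd ` q division_of \<Union>(snd ` q)"
  using partial_division_of_tagged_division[OF tagged_partial_division_subset[of p S q]] p q
  unfolding tagged_division_of_def by blast

text \<open>In a tagged division fine enough for the derivative estimate at good tags, the intervals
  with bad tags lie in an open set of small measure, where absolute continuity applies.\<close>

lemma abs_continuous_on_zero_derivative_AE:
  fixes f :: "real \<Rightarrow> 'a::real_normed_vector"
  assumes ab: "a \<le> b" and ac: "abs_continuous_on {a..b} f"
    and N: "negligible N"
    and der: "\<And>t. t \<in> {a..b} - N \<Longrightarrow> (f has_vector_derivative 0) (at t within {a..b})"
  shows "f b = f a"
proof -
  have "norm (f b - f a) \<le> \<epsilon>" if "\<epsilon> > 0" for \<epsilon>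
  proof -
    \<comment> \<open>The well-tagged intervals then contribute at most half of \<epsilon>; the 1
      covers the case a = b.\<close>
    define \<eta> where "\<eta> = \<epsilon> / (2 * (b - a + 1))"
    have \<eta>: "\<eta> > 0" using \<open>\<epsilon> > 0\<close> ab by (simp add: \<eta>_def)
    have "\<epsilon> / 2 > 0" using \<open>\<epsilon> > 0\<close> by simp
    then obtain d where d: "d > 0"
      "\<And>D. D division_of \<Union>D \<and> \<Union>D \<subseteq> {a..b} \<and> (\<Sum>I\<in>D. Sup I - Inf I) < d \<Longrightarrow>
        (\<Sum>I\<in>D. norm (f (Sup I) - f (Inf I))) < \<epsilon> / 2"
      using ac unfolding abs_continuous_on_def by meson
    have "N \<in> null_sets lebesgue" using N by (simp add: negligible_iff_null_sets)
    then obtain U where U: "open U" "N \<subseteq> U" "U - N \<in> lmeasurable" "emeasure lebesgue (U - N) < d"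
      using sets_lebesgue_outer_open[of N d] d(1) by (metis null_setsD2)
    have Um: "U \<in> lmeasurable" "measure lebesgue U < d"
    proof -
      have "U = (U - N) \<union> N" using U(2) by blast
      then show "U \<in> lmeasurable"
        using U(3) N by (metis fmeasurable.Un negligible_imp_measurable)
      have "measure lebesgue (U - N) = measure lebesgue U"
        using \<open>N \<in> null_sets lebesgue\<close> \<open>U \<in> lmeasurable\<close>
        by (simp add: measure_Diff_null_set fmeasurableD)
      moreover have "measure lebesgue (U - N) < d"
        using U(3,4) d(1) by (simp add: emeasure_eq_measure2 ennreal_less_iff)
      ultimately show "measure lebesgue U < d" by simp
    qed
    \<comment> \<open>One gauge for both kinds of tags: at points of \<open>N\<close> the ball stays
      inside \<open>U\<close>, and at good tags the vanishing derivative bounds the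
      increment.\<close>
    have "\<exists>r>0. (t \<in> N \<longrightarrow> ball t r \<subseteq> U) \<and> (t \<in> {a..b} - N \<longrightarrow>
        (\<forall>y\<in>{a..b}. norm (y - t) < r \<longrightarrow> norm (f y - f t) \<le> \<eta> * norm (y - t)))" for t
    proof (cases "t \<in> N")
      case True
      then show ?thesis using U(1,2) by (meson open_contains_ball subset_eq Diff_iff)
    next
      case False
      show ?thesis
      proof (cases "t \<in> {a..b}")
        case True
        then have "(f has_derivative (\<lambda>h. h *\<^sub>R 0)) (at t within {a..b})"
          using der[of t] False by (simp add: has_vector_derivative_def)
        then show ?thesis
          unfolding has_derivative_within_alt using False \<eta> by force
      qed (use False zero_less_one in blast)
    qed
    then obtain r where r: "\<And>t. r t > 0" "\<And>t. t \<in> N \<Longrightarrow> ball t (r t) \<subseteq> U"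
      "\<And>t y. t \<in> {a..b} - N \<Longrightarrow> y \<in> {a..b} \<Longrightarrow> norm (y - t) < r t \<Longrightarrow>
        norm (f y - f t) \<le> \<eta> * norm (y - t)"
      by metis
    have "gauge (\<lambda>t. ball t (r t))" using r(1) by (auto simp: gauge_def)
    then obtain p where p: "p tagged_division_of {a..b}" "(\<lambda>t. ball t (r t)) fine p"
      using fine_division_exists_real by blast
    define F where "F = (\<lambda>I. f (Sup I) - f (Inf I))"
    define q where "q = {(t, I) \<in> p. t \<in> N}"
    have qp: "q \<subseteq> p" unfolding q_def by auto
    have fin: "finite p" using p(1) by (rule tagged_division_of_finite)
    have tag: "t \<in> I" "I \<subseteq> {a..b}" "I \<subseteq> ball t (r t)" "I = {Inf I..Sup I}" "Inf I \<le> Sup I"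
      if "(t, I) \<in> p" for t I
    proof -
      show tI: "t \<in> I" and "I \<subseteq> {a..b}"
        using tagged_division_ofD(2,3)[OF p(1) that] by auto
      show "I \<subseteq> ball t (r t)" using fineD[OF p(2) that] .
      obtain c e :: real where "I = {c..e}"
        using tagged_division_ofD(4)[OF p(1) \<open>(t, I) \<in> p\<close>] by (auto simp: cbox_interval)
      with tI show "I = {Inf I..Sup I}" "Inf I \<le> Sup I" by auto
    qed
    have "f b - f a = (\<Sum>(t, I)\<in>p. F I)"
      using additive_tagged_division_1[OF ab p(1), of f] by (simp add: F_def)
    also have "\<dots> = (\<Sum>(t, I)\<in>p - q. F I) + (\<Sum>(t, I)\<in>q. F I)"
      by (rule sum.subset_diff[OF qp fin])
    finally have "norm (f b - f a) \<le> norm (\<Sum>(t, I)\<in>p - q. F I) + norm (\<Sum>(t, I)\<in>q. F I)"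
      by (metis norm_triangle_ineq)
    moreover have "norm (\<Sum>(t, I)\<in>p - q. F I) \<le> \<epsilon> / 2"
    proof -
      have "norm (\<Sum>(t, I)\<in>p - q. F I) \<le> (\<Sum>(t, I)\<in>p - q. \<eta> * (Sup I - Inf I))"
      proof (rule sum_norm_le, clarify)
        fix t I assume tI: "(t, I) \<in> p" "(t, I) \<notin> q"
        note I = tag[OF tI(1)]
        have "t \<in> {a..b} - N" using tI I(1,2) unfolding q_def by auto
        moreover have "Inf I \<in> I" "Sup I \<in> I"
          using I(4,5) by (metis atLeastAtMost_iff order_refl)+
        moreover from this have "norm (Inf I - t) < r t" "norm (Sup I - t) < r t"
          using I(3) by (auto simp: dist_norm norm_minus_commute)
        ultimately have le: "norm (f (Inf I) - f t) \<le> \<eta> * norm (Inf I - t)"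
          "norm (f (Sup I) - f t) \<le> \<eta> * norm (Sup I - t)"
          using r(3) I(2) by blast+
        have t: "Inf I \<le> t" "t \<le> Sup I" using I(1,4) by (metis atLeastAtMost_iff)+
        have "norm (F I) \<le> norm (f (Sup I) - f t) + norm (f (Inf I) - f t)"
          unfolding F_def using norm_triangle_ineq4[of "f (Sup I) - f t" "f (Inf I) - f t"] by simp
        also have "\<dots> \<le> \<eta> * (Sup I - t) + \<eta> * (t - Inf I)"
          using le t by simp
        finally show "norm (F I) \<le> \<eta> * (Sup I - Inf I)" by (simp add: algebra_simps)
      qed
      also have "\<dots> \<le> (\<Sum>(t, I)\<in>p. \<eta> * (Sup I - Inf I))"
        using tag(5) \<eta> by (intro sum_mono2[OF fin]) auto
      also have "\<dots> = \<eta> * (\<Sum>(t, I)\<in>p. Sup I - Inf I)"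
        by (simp add: sum_distrib_left case_prod_unfold)
      also have "(\<Sum>(t, I)\<in>p. Sup I - Inf I) = b - a"
        using additive_tagged_division_1[OF ab p(1), of "\<lambda>t. t"] by simp
      also have "\<eta> * (b - a) \<le> \<eta> * (b - a + 1)" using \<eta> by (intro mult_left_mono) auto
      also have "\<dots> = \<epsilon> / 2" using ab by (simp add: \<eta>_def field_simps)
      finally show ?thesis .
    qed
    moreover have "norm (\<Sum>(t, I)\<in>q. F I) \<le> \<epsilon> / 2"
    proof -
      have ne: "I \<noteq> {}" if "(t, I) \<in> q" for t I using tag(1) qp that by blast
      have "norm (\<Sum>(t, I)\<in>q. F I) \<le> (\<Sum>(t, I)\<in>q. norm (F I))"
        by (rule sum_norm_le) auto
      \<comment> \<open>Passing from tagged pairs to intervals requires a summand that vanishes on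
        all degenerate intervals. On a point \<open>F\<close> is 0 already; on the empty set
        \<open>Sup\<close> and \<open>Inf\<close> give no information, hence the guard.\<close>
      also have "\<dots> = (\<Sum>(t, I)\<in>q. if I = {} then 0 else norm (F I))"
        using ne by (intro sum.cong) auto
      also have "\<dots> = (\<Sum>I\<in>snd ` q. if I = {} then 0 else norm (F I))"
      proof (rule sum.over_tagged_division_lemma[of _ "\<Union>(snd ` q)"])
        have "q tagged_partial_division_of {a..b}"
          using p(1) qp tagged_partial_division_subset unfolding tagged_division_of_def by blast
        then show "q tagged_division_of \<Union>(snd ` q)"
          by (rule tagged_partial_division_of_Union_self)
      qed (auto simp: F_def box_eq_empty cbox_interval)
      also have "\<dots> = (\<Sum>I\<in>snd ` q. norm (F I))"
        using ne by (intro sum.cong) auto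
      also have "\<dots> < \<epsilon> / 2"
        unfolding F_def
      proof (rule d(2), intro conjI)
        show dq: "snd ` q division_of \<Union>(snd ` q)"
          by (rule tagged_division_subset_division_of[OF p(1) qp])
        show "\<Union>(snd ` q) \<subseteq> {a..b}" using tag(2) qp by fastforce
        \<comment> \<open>The intervals have disjoint interiors, so their total length is the
          measure of their union, which lies in \<open>U\<close>.\<close>
        have "(\<Sum>I\<in>snd ` q. Sup I - Inf I) = (\<Sum>I\<in>snd ` q. measure lebesgue I)"
        proof (rule sum.cong[OF refl])
          fix I assume "I \<in> snd ` q"
          then obtain t where "(t, I) \<in> p" using qp by auto
          then obtain c e where "I = {c..e}" "c \<le> e" using tag(4,5) by blast
          then show "Sup I - Inf I = measure lebesgue I" by simp
        qed
        also have "\<dots> = measure lebesgue (\<Union>(snd ` q))"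
          by (rule content_division[OF dq])
        also have "\<dots> \<le> measure lebesgue U"
        proof (rule measure_mono_fmeasurable)
          show "\<Union>(snd ` q) \<subseteq> U"
            using tag(3) r(2) unfolding q_def by fastforce
          show "\<Union>(snd ` q) \<in> sets lebesgue"
            using lmeasurable_division[OF dq] by (rule fmeasurableD)
        qed (rule Um)
        finally show "(\<Sum>I\<in>snd ` q. Sup I - Inf I) < d" using Um(2) by simp
      qed
      finally show ?thesis by simp
    qed
    ultimately show ?thesis by simp
  qed
  then have "norm (f b - f a) \<le> 0" by (rule field_le_epsilon[of _ 0, simplified])
  then show ?thesis by simp
qed

section \<open>Steering with piecewise constant controls\<close>

text \<open>An invariant suited to concatenation: one Lipschitz bound for the trajectory and
  finitely many switching times. This is stronger than being a Caratheodory solution. The control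
  lives on the whole line, so its bounds hold everywhere.\<close>

definition steering ::
  "real \<Rightarrow> ('c::topological_space \<Rightarrow> complex ^ 'm ^ 'm) \<Rightarrow> 'c set \<Rightarrow> real \<Rightarrow> (real \<Rightarrow> 'c) \<Rightarrow>
   (real \<Rightarrow> complex ^ 'm) \<Rightarrow> bool" where
  "steering hbar H K T u \<psi> \<longleftrightarrow> u \<in> borel_measurable borel \<and> range u \<subseteq> K \<and>
     (\<exists>L. L-lipschitz_on {0..T} \<psi>) \<and>
     (\<exists>S. finite S \<and> (\<forall>t\<in>{0..T} - S.
        (\<psi> has_vector_derivative schroedinger_field hbar (H (u t)) (\<psi> t)) (at t)))"

lemma steering_zero: "c \<in> K \<Longrightarrow> steering hbar H K 0 (\<lambda>_. c) (\<lambda>_. v)"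
  unfolding steering_def
  by (auto intro!: exI[of _ 0] exI[of _ "{0}"] lipschitz_onI)

text \<open>The norm is conserved and the field is bounded linear, so the speed is bounded uniformly
  in time.\<close>

lemma schroedinger_flow_lipschitz:
  fixes A :: "complex ^ 'm ^ 'm"
  assumes herm: "hermitian A"
    and x: "\<And>t. (x has_vector_derivative schroedinger_field hbar A (x t)) (at t)"
  obtains L where "L-lipschitz_on S x"
proof -
  obtain B where B: "\<And>v. norm (schroedinger_field hbar A v) \<le> norm v * B" "0 \<le> B"
    using bounded_linear.nonneg_bounded[OF bounded_linear_schroedinger_field] by blast
  have "(norm (x 0) * B)-lipschitz_on UNIV x"
  proof (rule bounded_derivative_imp_lipschitz)
    fix t
    show "(x has_derivative (\<lambda>h. h *\<^sub>R schroedinger_field hbar A (x t))) (at t within UNIV)"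
      using x[of t] by (simp add: has_vector_derivative_def)
    have "norm (x t) = norm (x 0)"
      by (rule norm_preserved[OF x inner_schroedinger_field[OF herm]])
    then have "norm (schroedinger_field hbar A (x t)) \<le> norm (x 0) * B" using B(1)[of "x t"] by simp
    then show "onorm (\<lambda>h. h *\<^sub>R schroedinger_field hbar A (x t)) \<le> norm (x 0) * B"
      by (intro onorm_le) (metis mult.commute mult_left_mono norm_ge_zero norm_scaleR real_norm_def)
  qed (use B(2) in simp_all)
  then show thesis using that lipschitz_on_subset by blast
qed

lemma steering_append:
  fixes H :: "'c::topological_space \<Rightarrow> complex ^ 'm ^ 'm"
  assumes st: "steering hbar H K T u \<psi>" and T: "0 \<le> T" and c: "c \<in> K" and herm: "hermitian (H c)"
    and x: "x 0 = \<psi> T" "\<And>t. (x has_vector_derivative schroedinger_field hbar (H c) (x t)) (at t)"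
    and t: "0 < t"
  shows "steering hbar H K (T + t) (\<lambda>s. if s \<le> T then u s else c)
    (\<lambda>s. if s \<le> T then \<psi> s else x (s - T))"
proof -
  let ?u = "\<lambda>s. if s \<le> T then u s else c" and ?\<psi> = "\<lambda>s. if s \<le> T then \<psi> s else x (s - T)"
  obtain L S where st': "u \<in> borel_measurable borel" "range u \<subseteq> K" "L-lipschitz_on {0..T} \<psi>"
    "finite S" "\<And>s. s \<in> {0..T} - S \<Longrightarrow>
      (\<psi> has_vector_derivative schroedinger_field hbar (H (u s)) (\<psi> s)) (at s)"
    using st unfolding steering_def by blast
  have shift: "((\<lambda>s. x (s - T)) has_vector_derivative schroedinger_field hbar (H c) (x (s - T))) (at s)"
    for s
  proof -
    have "((\<lambda>s. s - T) has_vector_derivative 1) (at s)" by (auto intro!: derivative_eq_intros)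
    from vector_diff_chain_at[OF this x(2)] show ?thesis by (simp add: o_def)
  qed
  have "?u \<in> borel_measurable borel"
    using st'(1) by (intro measurable_If) auto
  moreover have "range ?u \<subseteq> K" using st'(2) c by auto
  moreover have "\<exists>L. L-lipschitz_on {0..T + t} ?\<psi>"
  proof -
    obtain L' where L': "L'-lipschitz_on {T..T + t} (\<lambda>s. x (s - T))"
      using schroedinger_flow_lipschitz[OF herm shift] by metis
    show ?thesis
      by (intro exI[of _ "max L L'"] lipschitz_on_concat lipschitz_on_le[OF st'(3)]
          lipschitz_on_le[OF L']) (use x(1) in auto)
  qed
  moreover have "\<exists>S. finite S \<and> (\<forall>s\<in>{0..T + t} - S.
      (?\<psi> has_vector_derivative schroedinger_field hbar (H (?u s)) (?\<psi> s)) (at s))"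
  \<comment> \<open>At the switching time the one-sided derivatives may disagree, so
    \<open>T\<close> joins the exceptional set.\<close>
  proof (intro exI[of _ "insert T S"] conjI ballI)
    fix s assume s: "s \<in> {0..T + t} - insert T S"
    show "(?\<psi> has_vector_derivative schroedinger_field hbar (H (?u s)) (?\<psi> s)) (at s)"
    proof (cases "s < T")
      case True
      then have "(\<psi> has_vector_derivative schroedinger_field hbar (H (?u s)) (?\<psi> s)) (at s)"
        using st'(5)[of s] s by simp
      then show ?thesis
        by (rule has_vector_derivative_transform_within_open[of _ _ _ "{..<T}"]) (use True in auto)
    next
      case False
      then have "((\<lambda>s. x (s - T)) has_vector_derivative
          schroedinger_field hbar (H (?u s)) (?\<psi> s)) (at s)"
        using shift[of s] s by simp
      then show ?thesis
        by (rule has_vector_derivative_transform_within_open[of _ _ _ "{T<..}"])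
          (use False s in auto)
    qed
  qed (use st'(4) in simp)
  ultimately show ?thesis unfolding steering_def by blast
qed

text \<open>Holding \<open>H (c k)\<close> moves the overlap with \<open>p k\<close> over to \<open>p (Suc k)\<close>.\<close>

lemma steering_along_ground_states:
  fixes H :: "'c::topological_space \<Rightarrow> complex ^ 'm ^ 'm"
  assumes hbar: "0 < hbar" and g: "0 < g" and \<kappa>: "0 < \<kappa>" and \<beta>: "0 \<le> \<beta>"
    and K: "\<And>k. k \<le> N \<Longrightarrow> c k \<in> K" and herm: "\<And>k. k \<le> N \<Longrightarrow> hermitian (H (c k))"
    and gs: "\<And>k. k \<le> N \<Longrightarrow> ground_state (H (c k)) (e k) (p k) g"
    and overlap: "\<And>k. k < N \<Longrightarrow> 1 - \<beta> \<le> (cmod (braket (p k) (p (Suc k))))\<^sup>2"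
  shows "k \<le> N \<Longrightarrow> \<exists>T u \<psi>. steering hbar H K T u \<psi> \<and> 0 \<le> T \<and> (0 < k \<longrightarrow> 0 < T) \<and>
    \<psi> 0 = p 0 \<and> norm (\<psi> T) = 1 \<and> 1 - real k * (\<beta> + \<kappa>) \<le> (cmod (braket (p k) (\<psi> T)))\<^sup>2"
proof (induction k)
  case 0
  have "norm (p 0) = 1" using ground_state_norm[OF gs[of 0]] by simp
  then show ?case
    using steering_zero[OF K[of 0], of hbar H "p 0"] by (fastforce simp: braket_self)
next
  case (Suc k)
  then obtain T u \<psi> where IH: "steering hbar H K T u \<psi>" "0 \<le> T" "\<psi> 0 = p 0" "norm (\<psi> T) = 1"
    "1 - real k * (\<beta> + \<kappa>) \<le> (cmod (braket (p k) (\<psi> T)))\<^sup>2"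
    by auto
  have k: "k \<le> N" "k < N" using Suc.prems by auto
  obtain x t where x: "x 0 = \<psi> T"
    "\<And>t. (x has_vector_derivative schroedinger_field hbar (H (c k)) (x t)) (at t)" and t: "0 < t"
    and up: "(cmod (braket (p k) (p (Suc k))))\<^sup>2 * (cmod (braket (p k) (\<psi> T)))\<^sup>2 - \<kappa>
      \<le> (cmod (braket (p (Suc k)) (x t)))\<^sup>2"
    using hold_time_exists[OF herm[OF k(1)] gs[OF k(1)] g hbar \<kappa>] by metis
  have "norm (x t) = 1"
    using norm_preserved[OF x(2) inner_schroedinger_field[OF herm[OF k(1)]]] x(1) IH(4) by simp
  moreover have "1 - real (Suc k) * (\<beta> + \<kappa>) \<le> (cmod (braket (p (Suc k)) (x t)))\<^sup>2"
  proof -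
    define o1 where "o1 = (cmod (braket (p k) (\<psi> T)))\<^sup>2"
    \<comment> \<open>This is why norm 1 is part of the induction: for an overlap of at most 1,
      multiplication by 1 - \<beta> costs at most \<beta>, so the losses add.\<close>
    have "cmod (braket (p k) (\<psi> T)) \<le> 1"
      using cmod_braket_le[of "p k" "\<psi> T"] IH(4) ground_state_norm[OF gs[OF k(1)]] by simp
    then have o1: "0 \<le> o1" "o1 \<le> 1" by (auto simp: o1_def power_le_one)
    have "1 - real (Suc k) * (\<beta> + \<kappa>) \<le> o1 - \<beta> - \<kappa>"
      using IH(5) by (simp add: o1_def algebra_simps)
    also have "\<dots> \<le> (1 - \<beta>) * o1 - \<kappa>"
      using mult_left_mono[OF o1(2) \<beta>] by (simp add: algebra_simps)
    also have "\<dots> \<le> (cmod (braket (p k) (p (Suc k))))\<^sup>2 * o1 - \<kappa>"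
      using overlap[OF k(2)] o1(1) by (simp add: mult_right_mono)
    finally show ?thesis using up by (simp add: o1_def)
  qed
  ultimately show ?case
    using steering_append[where t = t, OF IH(1,2) K[OF k(1)] herm[OF k(1)] x t] IH(2,3) x(1) t
    by (intro exI[of _ "T + t"] exI[of _ "\<lambda>s. if s \<le> T then u s else c k"]
        exI[of _ "\<lambda>s. if s \<le> T then \<psi> s else x (s - T)"]) auto
qed

lemma steering_along_gapped_curve:
  fixes H :: "'c::topological_space \<Rightarrow> complex ^ 'm ^ 'm" and \<gamma> :: "real \<Rightarrow> 'c"
  assumes hbar: "0 < hbar" and g: "0 < g" and \<epsilon>: "0 < \<epsilon>"
    and K: "\<And>s. s \<in> {0..1} \<Longrightarrow> \<gamma> s \<in> K" and herm: "\<And>s. s \<in> {0..1} \<Longrightarrow> hermitian (H (\<gamma> s))"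
    and gs: "\<And>s. s \<in> {0..1} \<Longrightarrow> ground_state (H (\<gamma> s)) (e s) (p s) g"
    and lip: "\<And>s t v. s \<in> {0..1} \<Longrightarrow> t \<in> {0..1} \<Longrightarrow>
      norm (H (\<gamma> t) *v v - H (\<gamma> s) *v v) \<le> C * \<bar>t - s\<bar> * norm v"
  obtains T u \<psi> where "steering hbar H K T u \<psi>" "0 < T" "\<psi> 0 = p 0" "norm (\<psi> T) = 1"
    "1 - \<epsilon> \<le> (cmod (braket (p 1) (\<psi> T)))\<^sup>2"
proof -
  \<comment> \<open>Sample points are 1 / N apart, so the perturbation bound with D = C / N costs M
    / N^2 per step. Together with \<kappa> = 1 / N^2 this makes (M + 1) / N after N steps, which
    determines the choice of \<open>N\<close>.\<close>
  define M where "M = (2 * C / g)\<^sup>2"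
  obtain N :: nat where N: "(M + 1) / \<epsilon> < real N" using reals_Archimedean2 by blast
  have M0: "0 \<le> M" by (simp add: M_def)
  have N0: "0 < real N" using N M0 \<epsilon> by (smt (verit) divide_pos_pos)
  define c where "c k = real k / real N" for k
  have c: "c k \<in> {0..1}" if "k \<le> N" for k using that N0 by (simp add: c_def)
  define \<beta> where "\<beta> = M / (real N)\<^sup>2"
  define \<kappa> where "\<kappa> = 1 / (real N)\<^sup>2"
  have \<beta>: "0 \<le> \<beta>" and \<kappa>: "0 < \<kappa>" using M0 N0 by (auto simp: \<beta>_def \<kappa>_def)
  have overlap: "1 - \<beta> \<le> (cmod (braket (p (c k)) (p (c (Suc k)))))\<^sup>2" if "k < N" for k
  proof -
    have kk: "c k \<in> {0..1}" "c (Suc k) \<in> {0..1}" using c[of k] c[of "Suc k"] that by auto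
    have "c (Suc k) - c k = 1 / real N" by (simp add: c_def add_divide_distrib)
    then have "norm (H (\<gamma> (c (Suc k))) *v v - H (\<gamma> (c k)) *v v) \<le> C / real N * norm v" for v
      using lip[OF kk, of v] N0 by simp
    from ground_state_perturbation[OF herm[OF kk(1)] gs[OF kk(1)] herm[OF kk(2)] gs[OF kk(2)] g this]
    show ?thesis by (simp add: \<beta>_def M_def power_divide power_mult_distrib mult.commute)
  qed
  \<comment> \<open>The Hamiltonian at parameter 1 is never held; its ground state enters only as
    the target of the last step.\<close>
  have "\<exists>T u \<psi>. steering hbar H K T u \<psi> \<and> 0 \<le> T \<and> (0 < N \<longrightarrow> 0 < T) \<and> \<psi> 0 = p (c 0) \<and>
      norm (\<psi> T) = 1 \<and> 1 - real N * (\<beta> + \<kappa>) \<le> (cmod (braket (p (c N)) (\<psi> T)))\<^sup>2"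
    by (rule steering_along_ground_states[where c = "\<lambda>k. \<gamma> (c k)" and e = "\<lambda>k. e (c k)" and N = N,
          OF hbar g \<kappa> \<beta> K herm gs overlap])
      (auto simp: c[unfolded atLeastAtMost_iff])
  moreover have "c 0 = 0" "c N = 1" using N0 by (auto simp: c_def)
  moreover have "real N * (\<beta> + \<kappa>) \<le> \<epsilon>"
  proof -
    have "real N * (\<beta> + \<kappa>) = (M + 1) / real N"
      using N0 by (simp add: \<beta>_def \<kappa>_def field_simps power2_eq_square)
    also have "\<dots> \<le> \<epsilon>" using N N0 \<epsilon> by (simp add: field_simps)
    finally show ?thesis .
  qed
  ultimately obtain T u \<psi> where "steering hbar H K T u \<psi>" "0 < T" "\<psi> 0 = p 0" "norm (\<psi> T) = 1"
    "1 - real N * (\<beta> + \<kappa>) \<le> (cmod (braket (p 1) (\<psi> T)))\<^sup>2"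
    using N0 by auto
  with that \<open>real N * (\<beta> + \<kappa>) \<le> \<epsilon>\<close> show thesis
    by (smt (verit))
qed

text \<open>The first derivative is itself differentiable, hence continuous and bounded on the
  compact interval.\<close>

lemma smooth_curve_on_imp_lipschitz:
  fixes \<gamma> :: "real \<Rightarrow> 'a::real_normed_vector"
  assumes "smooth_curve_on {a..b} \<gamma>"
  obtains L where "L-lipschitz_on {a..b} \<gamma>"
proof -
  obtain D where D: "D (0::nat) = \<gamma>"
    "\<And>k s. s \<in> {a..b} \<Longrightarrow> (D k has_vector_derivative D (Suc k) s) (at s within {a..b})"
    using assms unfolding smooth_curve_on_def by blast
  have "continuous_on {a..b} (D 1)"
    using D(2)[of _ 1] by (rule continuous_on_vector_derivative)
  then have "bounded (D 1 ` {a..b})"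
    by (intro compact_imp_bounded compact_continuous_image) auto
  then obtain M where M: "M > 0" "\<And>s. s \<in> {a..b} \<Longrightarrow> norm (D 1 s) \<le> M"
    by (auto simp: bounded_pos)
  have "M-lipschitz_on {a..b} \<gamma>"
  proof (rule bounded_derivative_imp_lipschitz)
    fix s assume s: "s \<in> {a..b}"
    show "(\<gamma> has_derivative (\<lambda>h. h *\<^sub>R D 1 s)) (at s within {a..b})"
      using D(2)[OF s, of 0] D(1) by (simp add: has_vector_derivative_def)
    show "onorm (\<lambda>h. h *\<^sub>R D 1 s) \<le> M"
      using M(2)[OF s]
      by (intro onorm_le) (metis mult.commute mult_left_mono norm_ge_zero norm_scaleR real_norm_def)
  qed (use M(1) in auto)
  with that show thesis .
qed

section \<open>Existence and uniqueness of Caratheodory solutions\<close>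

lemma steering_imp_schroedinger_solution:
  assumes hbar: "hbar \<noteq> 0"
    and st: "steering hbar (hamiltonian hbar C6 r) K T u \<psi>" and init: "\<psi> 0 = ket (\<lambda>_. False)"
  shows "schroedinger_solution hbar C6 r T u \<psi>"
proof -
  obtain L S where "L-lipschitz_on {0..T} \<psi>" and S: "finite S" "\<And>t. t \<in> {0..T} - S \<Longrightarrow>
      (\<psi> has_vector_derivative schroedinger_field hbar (hamiltonian hbar C6 r (u t)) (\<psi> t)) (at t)"
    using st unfolding steering_def by blast
  have "AE t in lebesgue. t \<notin> S"
    using S(1) by (intro AE_not_in) (simp add: negligible_finite flip: negligible_iff_null_sets)
  then have "AE t in lebesgue_on {0..T}. t \<notin> S"
    by (auto simp: AE_restrict_space_iff elim: eventually_mono)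
  moreover have "AE t in lebesgue_on {0..T}. t \<in> {0..T}"
    using AE_space[of "lebesgue_on {0..T}"] by simp
  ultimately have "AE t in lebesgue_on {0..T}. \<exists>v. (\<psi> has_vector_derivative v) (at t within {0..T}) \<and>
      (\<i> * complex_of_real hbar) *s v = hamiltonian hbar C6 r (u t) *v \<psi> t"
  proof eventually_elim
    case (elim t)
    then show ?case
      using has_vector_derivative_at_within[OF S(2)[of t]]
      by (auto simp: schroedinger_field_iff[OF hbar])
  qed
  moreover have "abs_continuous_on {0..T} \<psi>"
    using \<open>L-lipschitz_on {0..T} \<psi>\<close> by (rule lipschitz_on_imp_abs_continuous_on)
  ultimately show ?thesis unfolding schroedinger_solution_def using init by blast
qed

text \<open>The difference of two solutions follows the same linear field, which is orthogonal to
  it, so its squared norm has derivative 0 almost everywhere. Absolute continuity turns this into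
  constancy. Estimates for one constructed trajectory thus hold for every solution.\<close>

lemma schroedinger_solution_unique:
  assumes hbar: "hbar \<noteq> 0" and T: "0 \<le> T" and herm: "\<And>c. hermitian (hamiltonian hbar C6 r c)"
    and \<psi>: "schroedinger_solution hbar C6 r T u \<psi>" and \<phi>: "schroedinger_solution hbar C6 r T u \<phi>"
  shows "\<psi> T = \<phi> T"
proof -
  let ?F = "\<lambda>t. schroedinger_field hbar (hamiltonian hbar C6 r (u t))"
  define y where "y t = \<psi> t - \<phi> t" for t
  have deriv: "AE t in lebesgue_on {0..T}. (\<psi> has_vector_derivative ?F t (\<psi> t)) (at t within {0..T})"
    if "schroedinger_solution hbar C6 r T u \<psi>" for \<psi>
    using that unfolding schroedinger_solution_def by (auto simp: schroedinger_field_iff[OF hbar])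
  have "AE t in lebesgue_on {0..T}.
      ((\<lambda>t. (norm (y t))\<^sup>2) has_vector_derivative 0) (at t within {0..T})"
    using deriv[OF \<psi>] deriv[OF \<phi>]
  proof eventually_elim
    case (elim t)
    then have "(y has_vector_derivative ?F t (\<psi> t) - ?F t (\<phi> t)) (at t within {0..T})"
      unfolding y_def by (rule has_vector_derivative_diff)
    also have "?F t (\<psi> t) - ?F t (\<phi> t) = ?F t (y t)"
      unfolding y_def by (simp add: linear_diff bounded_linear.linear bounded_linear_schroedinger_field)
    finally have y: "(y has_vector_derivative ?F t (y t)) (at t within {0..T})" .
    have "y t \<bullet> ?F t (y t) = 0" by (rule inner_schroedinger_field[OF herm])
    then show ?case
      using bounded_bilinear.has_vector_derivative[OF bounded_bilinear_inner y y]
      by (simp add: power2_norm_eq_inner inner_commute)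
  qed
  then obtain N where N: "N \<in> null_sets (lebesgue_on {0..T})"
    "\<And>t. t \<in> {0..T} - N \<Longrightarrow> ((\<lambda>t. (norm (y t))\<^sup>2) has_vector_derivative 0) (at t within {0..T})"
    by (auto elim!: AE_E3)
  have "negligible N"
    using N(1) by (simp add: negligible_iff_null_sets null_sets_restrict_space)
  moreover have "abs_continuous_on {0..T} (\<lambda>t. (norm (y t))\<^sup>2)"
    using \<psi> \<phi> unfolding y_def schroedinger_solution_def
    by (intro abs_continuous_on_norm_power2 abs_continuous_on_diff) auto
  ultimately have "(norm (y T))\<^sup>2 = (norm (y 0))\<^sup>2"
    using N(2) by (intro abs_continuous_on_zero_derivative_AE[OF T])
  also have "\<dots> = 0" using \<psi> \<phi> by (simp add: y_def schroedinger_solution_def)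
  finally show ?thesis by (simp add: y_def)
qed

section \<open>The Hamiltonian and its endpoint ground states\<close>

lemma hermitian_if_entries:
  fixes A :: "complex ^ 'm ^ 'm"
  assumes "\<And>i j. cnj (A $ i $ j) = A $ j $ i"
  shows "hermitian A"
  unfolding hermitian_def
proof (intro allI)
  fix u v
  have "braket (A *v u) v = (\<Sum>i\<in>UNIV. \<Sum>j\<in>UNIV. cnj (u $ j) * A $ j $ i * v $ i)"
    using assms
    by (simp add: braket_def matrix_vector_mult_def sum_distrib_left mult.commute mult.left_commute)
  also have "\<dots> = (\<Sum>j\<in>UNIV. \<Sum>i\<in>UNIV. cnj (u $ j) * A $ j $ i * v $ i)"
    by (rule sum.swap)
  also have "\<dots> = braket u (A *v v)"
    by (simp add: braket_def matrix_vector_mult_def sum_distrib_left mult.assoc)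
  finally show "braket (A *v u) v = braket u (A *v v)" .
qed

lemma n_op_entry: "n_op k $ x $ y = (if y = x \<and> x k then 1 else 0)"
  by (auto simp: on_factor_def number_matrix_def fun_eq_iff)

lemma n_op_mult_n_op_entry:
  "(n_op i ** n_op j) $ x $ y = (if y = x \<and> x i \<and> x j then 1 else 0)"
proof -
  have "(n_op i ** n_op j) $ x $ y = (\<Sum>z\<in>UNIV. n_op i $ x $ z * n_op j $ z $ y)"
    by (simp add: matrix_matrix_mult_def)
  also have "\<dots> = (\<Sum>z\<in>UNIV. if z = x then (if y = x \<and> x i \<and> x j then 1 else 0) else 0)"
    by (rule sum.cong) (auto simp: n_op_entry)
  finally show ?thesis by simp
qed

lemma n_op_apply: "(n_op k *v v) $ x = of_bool (x k) * v $ x"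
proof -
  have "(n_op k *v v) $ x = (\<Sum>y\<in>UNIV. n_op k $ x $ y * v $ y)"
    by (simp add: matrix_vector_mult_def)
  also have "\<dots> = (\<Sum>y\<in>UNIV. if y = x then of_bool (x k) * v $ x else 0)"
    by (rule sum.cong) (auto simp: n_op_entry)
  finally show ?thesis by simp
qed

lemma n_op_mult_n_op_apply: "((n_op i ** n_op j) *v v) $ x = of_bool (x i) * of_bool (x j) * v $ x"
  by (simp add: n_op_apply flip: matrix_vector_mul_assoc)

lemma hermitian_n_op: "hermitian (n_op k)"
  by (rule hermitian_if_entries) (auto simp: n_op_entry)

lemma hermitian_n_op_mult_n_op: "hermitian (n_op i ** n_op j)"
  by (rule hermitian_if_entries) (auto simp: n_op_mult_n_op_entry)

lemma hermitian_X_op: "hermitian (X_op k)"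
  by (rule hermitian_if_entries) (auto simp: on_factor_def pauli_X_def)

lemma hermitian_hamiltonian: "hermitian (hamiltonian hbar C6 r c)"
  unfolding hamiltonian_def H_interaction_def case_prod_unfold
  by (intro hermitian_diff hermitian_add hermitian_scaleR hermitian_sum hermitian_X_op
      hermitian_n_op hermitian_n_op_mult_n_op)

text \<open>The Hamiltonian is affine in the control: the interaction cancels in a difference, and
  two fixed bounded operators remain.\<close>

lemma hamiltonian_lipschitz:
  obtains C where "0 \<le> C" "\<And>a b v. norm (hamiltonian hbar C6 r a *v v - hamiltonian hbar C6 r b *v v)
    \<le> C * norm (a - b) * norm v"
proof -
  define X :: "'a operator" where "X = (\<Sum>k\<in>UNIV. X_op k)"
  define N :: "'a operator" where "N = (\<Sum>k\<in>UNIV. n_op k)"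
  have "bounded_linear ((*v) X)" "bounded_linear ((*v) N)" by auto
  then obtain B B' where B: "\<And>v. norm (X *v v) \<le> norm v * B" "0 \<le> B"
    "\<And>v. norm (N *v v) \<le> norm v * B'" "0 \<le> B'"
    by (metis bounded_linear.nonneg_bounded)
  show thesis
  proof (rule that)
    fix a b :: "real \<times> real" and v
    have eq: "hamiltonian hbar C6 r a *v v - hamiltonian hbar C6 r b *v v =
        (hbar * (fst a - fst b) / 2) *\<^sub>R (X *v v) - (hbar * (snd a - snd b)) *\<^sub>R (N *v v)"
      by (simp add: hamiltonian_def case_prod_unfold matrix_vector_mult_diff_rdistrib
          matrix_vector_mult_add_rdistrib scaleR_matrix_vector_mult diff_divide_distrib
          algebra_simps flip: X_def N_def)
    have ab: "\<bar>fst a - fst b\<bar> \<le> norm (a - b)" "\<bar>snd a - snd b\<bar> \<le> norm (a - b)"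
      using norm_fst_le[of "fst (a - b)" "snd (a - b)", unfolded prod.collapse]
        norm_snd_le[of "snd (a - b)" "fst (a - b)", unfolded prod.collapse]
      by auto
    have "norm (hamiltonian hbar C6 r a *v v - hamiltonian hbar C6 r b *v v) \<le>
        \<bar>hbar\<bar> * \<bar>fst a - fst b\<bar> / 2 * norm (X *v v) + \<bar>hbar\<bar> * \<bar>snd a - snd b\<bar> * norm (N *v v)"
      unfolding eq by (rule order_trans[OF norm_triangle_ineq4]) (simp add: abs_mult)
    also have "\<dots> \<le> \<bar>hbar\<bar> * norm (a - b) / 2 * (norm v * B) + \<bar>hbar\<bar> * norm (a - b) * (norm v * B')"
      using B ab by (intro add_mono mult_mono divide_right_mono) auto
    finally show "norm (hamiltonian hbar C6 r a *v v - hamiltonian hbar C6 r b *v v)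
        \<le> (\<bar>hbar\<bar> * B / 2 + \<bar>hbar\<bar> * B') * norm (a - b) * norm v"
      by (simp add: algebra_simps)
  qed (use B in simp)
qed

section \<open>Energies of bitstrings when the drive vanishes\<close>

definition classical_energy ::
  "real \<Rightarrow> real \<Rightarrow> ('n::{finite,linorder} \<Rightarrow> 'a::real_normed_vector) \<Rightarrow> real \<Rightarrow> ('n \<Rightarrow> bool) \<Rightarrow> real" where
  "classical_energy hbar C6 r \<delta> x =
     (\<Sum>(i, j)\<in>{(i, j). i < j}. vdW C6 r i j * of_bool (x i) * of_bool (x j))
       - hbar * \<delta> * real (card {k. x k})"

lemma hamiltonian_ket:
  fixes r :: "'n::{finite,linorder} \<Rightarrow> 'a::real_normed_vector"
  shows "hamiltonian hbar C6 r (0, \<delta>) *v ket x =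
    complex_of_real (classical_energy hbar C6 r \<delta> x) *s ket x"
proof -
  have ket: "ket x $ y = of_bool (y = x)" for x y :: "'n \<Rightarrow> bool" by (simp add: ket_def axis_def)
  have "n_op k *v ket x = of_bool (x k) *\<^sub>R ket x" for k
    by (auto simp: vec_eq_iff n_op_apply ket)
  then have N: "(\<Sum>k\<in>UNIV. n_op k) *v ket x = real (card {k. x k}) *\<^sub>R ket x"
    by (simp add: matrix_vector_mult_sum flip: scaleR_sum_left)
  have NN: "(n_op i ** n_op j) *v ket x = (of_bool (x i) * of_bool (x j)) *\<^sub>R ket x" for i j
    by (auto simp: vec_eq_iff n_op_mult_n_op_apply ket)
  have "H_interaction C6 r *v ket x =
      (\<Sum>(i, j)\<in>{(i, j). i < j}. vdW C6 r i j * of_bool (x i) * of_bool (x j)) *\<^sub>R ket x"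
    by (simp add: H_interaction_def matrix_vector_mult_sum case_prod_unfold
        scaleR_matrix_vector_mult NN scaleR_sum_left mult.assoc)
  then show ?thesis
    unfolding of_real_vector_scale
    by (simp add: hamiltonian_def classical_energy_def matrix_vector_mult_diff_rdistrib
        scaleR_matrix_vector_mult N scaleR_diff_left)
qed

lemma braket_ket: "braket (ket x) v = v $ x"
proof -
  have "braket (ket x) v = (\<Sum>i\<in>UNIV. if i = x then v $ x else 0)"
    unfolding braket_def by (intro sum.cong) (auto simp: ket_def axis_def)
  then show ?thesis by simp
qed

lemma norm_ket: "norm (ket x) = 1"
  by (simp add: ket_def)

text \<open>Some coordinate \<open>p $ x\<close> is nonzero. Moving \<open>A\<close> across the form
  between \<open>p\<close> and \<open>ket x\<close> shows that both have the same energy, and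
  uniqueness under a positive gap makes \<open>ket x\<close> a unit multiple of
  \<open>p\<close>.\<close>

lemma diagonal_ground_state:
  assumes herm: "hermitian A" and gs: "ground_state A e p g" and g: "0 < g"
    and diag: "\<And>x. A *v ket x = complex_of_real (\<E> x) *s ket x"
  obtains x where "ground_state A (\<E> x) (ket x) g" "\<And>y. \<E> x \<le> \<E> y"
proof -
  have "p \<noteq> 0" using ground_state_norm[OF gs] by auto
  then obtain x where "p $ x \<noteq> 0" by (auto simp: vec_eq_iff)
  then have px: "braket p (ket x) \<noteq> 0"
    by (metis braket_ket cnj_braket complex_cnj_zero_iff)
  have "braket (A *v p) (ket x) = braket p (A *v ket x)" by (rule hermitian_braket[OF herm])
  then have e: "\<E> x = e"
    using px by (simp add: ground_state_eigen[OF gs] diag braket_scale_left braket_scale_right)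
  define b where "b = braket p (ket x)"
  have ket: "ket x = b *s p"
    unfolding b_def using diag[of x] e by (intro ground_state_unique[OF herm gs g]) simp
  then have b: "cmod b = 1"
    using norm_ket[of x] ground_state_norm[OF gs] by (simp add: norm_vector_scale)
  have "ground_state A e (ket x) g"
    unfolding ground_state_def
  proof (intro conjI allI impI)
    show "A *v ket x = complex_of_real e *s ket x" using diag[of x] e by simp
    fix w assume "braket (ket x) w = 0"
    then have "braket p w = 0" using b unfolding ket by (auto simp: braket_scale_left)
    then show "(e + g) * (norm w)\<^sup>2 \<le> w \<bullet> (A *v w)"
      using gs unfolding ground_state_def by blast
  qed (rule norm_ket)
  moreover have "\<E> x \<le> \<E> y" for y
    using ground_state_minimal[OF herm gs, of "ket y"] g
    by (simp add: e diag of_real_vector_scale norm_ket flip: power2_norm_eq_inner)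
  ultimately show thesis using that e by blast
qed

lemma vdW_nonneg: "0 < C6 \<Longrightarrow> 0 \<le> vdW C6 r i j"
  by (simp add: vdW_def)

lemma classical_energy_empty: "classical_energy hbar C6 r \<delta> (\<lambda>_. False) = 0"
  by (simp add: classical_energy_def)

text \<open>With negative detuning every occupied vertex costs energy, and the repulsion never gives
  any back.\<close>

lemma classical_energy_minimal_start:
  fixes x :: "'n::{finite,linorder} \<Rightarrow> bool"
  assumes "0 < C6" "0 < hbar" "0 < \<delta>"
    and "classical_energy hbar C6 r (- \<delta>) x \<le> classical_energy hbar C6 r (- \<delta>) (\<lambda>_. False)"
  shows "x = (\<lambda>_. False)"
proof -
  have "0 \<le> (\<Sum>(i, j)\<in>{(i, j). i < j}. vdW C6 r i j * of_bool (x i) * of_bool (x j))"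
    using vdW_nonneg[OF assms(1)] by (intro sum_nonneg) auto
  moreover have "hbar * \<delta> * real (card {k. x k}) +
      (\<Sum>(i, j)\<in>{(i, j). i < j}. vdW C6 r i j * of_bool (x i) * of_bool (x j)) \<le> 0"
    using assms(4) unfolding classical_energy_empty by (simp add: classical_energy_def)
  ultimately have "hbar * \<delta> * real (card {k. x k}) \<le> 0" by linarith
  then have "card {k. x k} = 0" using assms(2,3) by (simp add: mult_le_0_iff)
  then show ?thesis by (simp add: fun_eq_iff)
qed

lemma interaction_eq_tail_energy:
  assumes "encodes_independent E x"
  shows "(\<Sum>(i, j)\<in>{(i, j). i < j}. vdW C6 r i j * of_bool (x i) * of_bool (x j)) = tail_energy C6 r E x"
  unfolding tail_energy_def
  using assms by (intro sum.mono_neutral_right) (auto simp: encodes_independent_def)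

lemma interaction_ge_edge:
  fixes r :: "'n::{finite,linorder} \<Rightarrow> 'a::real_normed_vector"
  assumes C6: "0 < C6" and graph: "simple_graph E" and layout: "unit_disk_realization E r R"
    and dep: "\<not> encodes_independent E x"
  shows "C6 / R ^ 6 \<le> (\<Sum>(i, j)\<in>{(i, j). i < j}. vdW C6 r i j * of_bool (x i) * of_bool (x j))"
proof -
  obtain a b where ab: "{a, b} \<in> E" "x a" "x b" using dep unfolding encodes_independent_def by blast
  \<comment> \<open>Edges have two elements, which excludes loops; the interaction sums only over
    ordered pairs, so the edge must then be oriented.\<close>
  have "a \<noteq> b" using graph ab(1) unfolding simple_graph_def by fastforce
  then obtain i j where ij: "i < j" "{i, j} \<in> E" "x i" "x j"
  proof (cases "a < b")
    case False
    have "{b, a} \<in> E" using ab(1) by (simp add: insert_commute)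
    moreover have "b < a" using \<open>a \<noteq> b\<close> False by simp
    ultimately show ?thesis using that ab(2,3) by blast
  qed (use ab in blast)
  have "r i \<noteq> r j" using layout ij(1) unfolding unit_disk_realization_def inj_def by force
  then have n: "0 < norm (r i - r j)" by simp
  have le: "norm (r i - r j) \<le> R" using layout ij(2) unfolding unit_disk_realization_def by blast
  have "0 < R * norm (r i - r j)"
    using n layout unfolding unit_disk_realization_def by (intro mult_pos_pos) auto
  then have "0 < R ^ 6 * norm (r i - r j) ^ 6" by (metis power_mult_distrib zero_less_power)
  moreover have "norm (r i - r j) ^ 6 \<le> R ^ 6" using le by (rule power_mono) simp
  ultimately have "C6 / R ^ 6 \<le> vdW C6 r i j"
    unfolding vdW_def using C6 by (intro divide_left_mono) auto
  also have "\<dots> = (\<Sum>(i, j)\<in>{(i, j)}. vdW C6 r i j * of_bool (x i) * of_bool (x j))"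
    using ij by simp
  also have "\<dots> \<le> (\<Sum>(i, j)\<in>{(i, j). i < j}. vdW C6 r i j * of_bool (x i) * of_bool (x j))"
    using ij vdW_nonneg[OF C6, of r] by (intro sum_mono2) auto
  finally show ?thesis .
qed

text \<open>Each tail condition excludes one kind of competitor. A violated edge costs at least
  \<open>C6 / R ^ 6\<close>, more than the whole detuning reward, so a dependent set has positive
  energy and loses to the empty one. Among independent sets one more vertex gains
  \<open>hbar * \<delta>\<close>, more than any tail energy can cost.\<close>

lemma classical_energy_minimal_in_MIS:
  fixes r :: "'n::{finite,linorder} \<Rightarrow> 'a::real_normed_vector"
  assumes pos: "0 < C6" "0 < hbar" "0 < \<delta>"
    and graph: "simple_graph E" and layout: "unit_disk_realization E r R"
    and H0: "tail_energy_max C6 r E < hbar * \<delta>"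
      "hbar * \<delta> * real CARD('n) + tail_energy_max C6 r E < C6 / R ^ 6"
    and min: "\<And>y. classical_energy hbar C6 r \<delta> x \<le> classical_energy hbar C6 r \<delta> y"
  shows "x \<in> MIS E"
proof -
  have tail_le: "tail_energy C6 r E y \<le> tail_energy_max C6 r E" if "encodes_independent E y" for y
    unfolding tail_energy_max_def using that by (intro Max_ge) auto
  have tail0: "0 \<le> tail_energy C6 r E y" for y
    unfolding tail_energy_def using vdW_nonneg[OF pos(1)] by (intro sum_nonneg) auto
  have "encodes_independent E (\<lambda>_. False)" by (simp add: encodes_independent_def)
  then have max0: "0 \<le> tail_energy_max C6 r E" using tail_le tail0 by (meson order_trans)
  have indep: "encodes_independent E x"
  proof (rule ccontr)
    assume "\<not> encodes_independent E x"
    note interaction_ge_edge[OF pos(1) graph layout this]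
    moreover have "hbar * \<delta> * real (card {k. x k}) \<le> hbar * \<delta> * real CARD('n)"
      using pos by (intro mult_left_mono) (auto intro: card_mono)
    ultimately have "0 < classical_energy hbar C6 r \<delta> x"
      using H0(2) max0 unfolding classical_energy_def by linarith
    with min[of "\<lambda>_. False"] show False by (simp add: classical_energy_empty)
  qed
  have "card {k. y k} \<le> card {k. x k}" if y: "encodes_independent E y" for y
  proof (rule ccontr)
    assume "\<not> card {k. y k} \<le> card {k. x k}"
    then have "real (card {k. x k}) + 1 \<le> real (card {k. y k})" by linarith
    then have "hbar * \<delta> * (real (card {k. x k}) + 1) \<le> hbar * \<delta> * real (card {k. y k})"
      using pos by (intro mult_left_mono) auto
    moreover have "classical_energy hbar C6 r \<delta> x \<le> classical_energy hbar C6 r \<delta> y" by (rule min)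
    ultimately show False
      unfolding classical_energy_def interaction_eq_tail_energy[OF indep]
        interaction_eq_tail_energy[OF y]
      using tail_le[OF y] tail0[of x] H0(1) by (simp add: algebra_simps)
  qed
  with indep show ?thesis unfolding MIS_def by blast
qed

text \<open>A single maximum independent set suffices: the projection onto its basis vector lies in
  the target space, and the remainder carries the squared norm that the overlap leaves.\<close>

lemma overlap_MIS:
  assumes x: "x \<in> MIS E" and n: "norm v = 1" and \<epsilon>: "0 \<le> \<epsilon>"
    and ov: "1 - \<epsilon>\<^sup>2 \<le> (cmod (braket (ket x) v))\<^sup>2"
  shows "infdist v (H_MIS E) \<le> \<epsilon>" "1 - \<epsilon>\<^sup>2 \<le> (\<Sum>x\<in>MIS E. (cmod (braket (ket x) v))\<^sup>2)"
proof -
  let ?w = "braket (ket x) v *s ket x"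
  have "ket x \<in> H_MIS E" unfolding H_MIS_def using x by (intro vec.span_base) auto
  then have "?w \<in> H_MIS E" unfolding H_MIS_def by (rule vec.span_scale)
  then have "infdist v (H_MIS E) \<le> norm (v - ?w)" by (metis dist_norm infdist_le)
  moreover have "(norm (v - ?w))\<^sup>2 \<le> \<epsilon>\<^sup>2"
    using orthogonal_part(2)[OF norm_ket, of v x] n ov by simp
  ultimately show "infdist v (H_MIS E) \<le> \<epsilon>" using \<epsilon> by (meson order_trans power2_le_imp_le)
  have "(cmod (braket (ket x) v))\<^sup>2 \<le> (\<Sum>x\<in>MIS E. (cmod (braket (ket x) v))\<^sup>2)"
    using x by (intro member_le_sum) auto
  with ov show "1 - \<epsilon>\<^sup>2 \<le> (\<Sum>x\<in>MIS E. (cmod (braket (ket x) v))\<^sup>2)" by linarith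
qed

theorem theorem4p4p6:
  fixes E :: "'n::{finite,linorder} set set"
    and r :: "'n \<Rightarrow> real ^ 'd"
    and R\<^sub>b C\<^sub>6 hbar \<Omega>\<^sub>m\<^sub>a\<^sub>x \<delta>\<^sub>m\<^sub>a\<^sub>x \<delta>\<^sub>0 :: real
  assumes dim: "CARD('d) = 2 \<or> CARD('d) = 3"
    and graph: "simple_graph E"
    and layout: "unit_disk_realization E r R\<^sub>b"
    and pos: "0 < C\<^sub>6" "0 < hbar" "0 < \<Omega>\<^sub>m\<^sub>a\<^sub>x" "0 < \<delta>\<^sub>m\<^sub>a\<^sub>x"
    and H0: "0 < \<delta>\<^sub>0"
      "tail_energy_max C\<^sub>6 r E < hbar * \<delta>\<^sub>0"
      "hbar * \<delta>\<^sub>0 * real CARD('n) + tail_energy_max C\<^sub>6 r E < C\<^sub>6 / R\<^sub>b ^ 6"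
    and H1: "\<exists>\<gamma> :: real \<Rightarrow> real \<times> real.
      smooth_curve_on {0..1} \<gamma> \<and>
      \<gamma> ` {0..1} \<subseteq> {0..\<Omega>\<^sub>m\<^sub>a\<^sub>x} \<times> {-\<delta>\<^sub>m\<^sub>a\<^sub>x..\<delta>\<^sub>m\<^sub>a\<^sub>x} \<and>
      \<gamma> 0 = (0, - \<delta>\<^sub>0) \<and> \<gamma> 1 = (0, \<delta>\<^sub>0) \<and>
      (\<exists>s\<^sub>0\<in>{0..1}.
        (\<forall>s\<in>{0..1}. spectral_gap (hamiltonian hbar C\<^sub>6 r (\<gamma> s\<^sub>0))
                      \<le> spectral_gap (hamiltonian hbar C\<^sub>6 r (\<gamma> s))) \<and>
        0 < spectral_gap (hamiltonian hbar C\<^sub>6 r (\<gamma> s\<^sub>0)))"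
  shows "\<forall>\<epsilon>>0. \<exists>T>0. \<exists>\<Omega> \<delta> :: real \<Rightarrow> real.
      L_infinity {0<..<T} (\<lambda>t. (\<Omega> t, \<delta> t)) \<and>
      (AE t in lebesgue_on {0<..<T}. \<Omega> t \<in> {0..\<Omega>\<^sub>m\<^sub>a\<^sub>x} \<and> \<delta> t \<in> {-\<delta>\<^sub>m\<^sub>a\<^sub>x..\<delta>\<^sub>m\<^sub>a\<^sub>x}) \<and>
      (\<exists>\<psi>. schroedinger_solution hbar C\<^sub>6 r T (\<lambda>t. (\<Omega> t, \<delta> t)) \<psi>) \<and>
      (\<forall>\<psi>. schroedinger_solution hbar C\<^sub>6 r T (\<lambda>t. (\<Omega> t, \<delta> t)) \<psi> \<longrightarrow>
        infdist (\<psi> T) (H_MIS E) \<le> \<epsilon> \<and>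
        (\<Sum>x\<in>MIS E. (cmod (braket (ket x) (\<psi> T)))\<^sup>2) \<ge> 1 - \<epsilon>\<^sup>2)"
proof -
  let ?H = "hamiltonian hbar C\<^sub>6 r"
  define K where "K = {0..\<Omega>\<^sub>m\<^sub>a\<^sub>x} \<times> {-\<delta>\<^sub>m\<^sub>a\<^sub>x..\<delta>\<^sub>m\<^sub>a\<^sub>x}"
  obtain \<gamma> s\<^sub>0 where \<gamma>: "smooth_curve_on {0..1} \<gamma>" "\<gamma> ` {0..1} \<subseteq> K" "\<gamma> 0 = (0, - \<delta>\<^sub>0)" "\<gamma> 1 = (0, \<delta>\<^sub>0)"
    and gap: "\<And>s. s \<in> {0..1} \<Longrightarrow> spectral_gap (?H (\<gamma> s\<^sub>0)) \<le> spectral_gap (?H (\<gamma> s))"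
      "0 < spectral_gap (?H (\<gamma> s\<^sub>0))"
    using H1 unfolding K_def by blast
  \<comment> \<open>The minimal gap. Each ground state is weakened to this common value, since the
    steering argument uses one constant for the whole curve.\<close>
  define g where "g = spectral_gap (?H (\<gamma> s\<^sub>0))"
  have g: "0 < g" using gap(2) by (simp add: g_def)
  have "2 \<le> CARD('n \<Rightarrow> bool)"
    using power_increasing[of 1 "CARD('n)" "2::nat"] by (simp add: card_fun Suc_leI)
  then have gs0: "\<exists>e p. ground_state (?H (\<gamma> s)) e p g" if "s \<in> {0..1}" for s
    using ground_state_of_spectral_gap[OF hermitian_hamiltonian, of hbar C\<^sub>6 r "\<gamma> s"] gap that
      ground_state_gap_mono unfolding g_def by (metis order_less_le_trans)
  obtain x0 where x0: "ground_state (?H (\<gamma> 0)) (classical_energy hbar C\<^sub>6 r (- \<delta>\<^sub>0) x0) (ket x0) g"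
    "\<And>y. classical_energy hbar C\<^sub>6 r (- \<delta>\<^sub>0) x0 \<le> classical_energy hbar C\<^sub>6 r (- \<delta>\<^sub>0) y"
    using gs0[of 0] diagonal_ground_state[OF hermitian_hamiltonian _ g hamiltonian_ket] \<gamma>(3)
    by (metis atLeastAtMost_iff order_refl zero_le_one)
  have x0_eq: "x0 = (\<lambda>_. False)"
    by (rule classical_energy_minimal_start[OF pos(1,2) H0(1) x0(2)])
  obtain x1 where x1: "ground_state (?H (\<gamma> 1)) (classical_energy hbar C\<^sub>6 r \<delta>\<^sub>0 x1) (ket x1) g"
    "\<And>y. classical_energy hbar C\<^sub>6 r \<delta>\<^sub>0 x1 \<le> classical_energy hbar C\<^sub>6 r \<delta>\<^sub>0 y"
    using gs0[of 1] diagonal_ground_state[OF hermitian_hamiltonian _ g hamiltonian_ket] \<gamma>(4)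
    by (metis atLeastAtMost_iff order_refl zero_le_one)
  have x1_MIS: "x1 \<in> MIS E"
    by (rule classical_energy_minimal_in_MIS[OF pos(1,2) H0(1) graph layout H0(2,3) x1(2)])
  \<comment> \<open>Ground states are determined only up to a phase. At the ends the phase is fixed,
    so that the trajectory starts exactly at the prescribed initial state and ends near a basis
    vector.\<close>
  have "\<exists>e p. ground_state (?H (\<gamma> s)) e p g \<and> (s = 0 \<longrightarrow> p = ket x0) \<and> (s = 1 \<longrightarrow> p = ket x1)"
    if "s \<in> {0..1}" for s
    using gs0[OF that] x0(1) x1(1) by (cases "s = 0"; cases "s = 1") auto
  then obtain e p where gs: "\<And>s. s \<in> {0..1} \<Longrightarrow> ground_state (?H (\<gamma> s)) (e s) (p s) g"
    and "p 0 = ket x0" "p 1 = ket x1"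
    by (metis atLeastAtMost_iff order_refl zero_le_one)
  obtain L where L: "L-lipschitz_on {0..1} \<gamma>" using smooth_curve_on_imp_lipschitz[OF \<gamma>(1)] .
  obtain C where C: "0 \<le> C" "\<And>a b v. norm (?H a *v v - ?H b *v v) \<le> C * norm (a - b) * norm v"
    using hamiltonian_lipschitz[of hbar C\<^sub>6 r] by blast
  have lip: "norm (?H (\<gamma> t) *v v - ?H (\<gamma> s) *v v) \<le> (C * L) * \<bar>t - s\<bar> * norm v"
    if "s \<in> {0..1}" "t \<in> {0..1}" for s t v
  proof -
    have "norm (\<gamma> t - \<gamma> s) \<le> L * \<bar>t - s\<bar>"
      using lipschitz_onD[OF L that(2,1)] by (simp add: dist_norm)
    then have "C * norm (\<gamma> t - \<gamma> s) * norm v \<le> C * (L * \<bar>t - s\<bar>) * norm v"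
      using C(1) by (intro mult_left_mono mult_right_mono) auto
    with C(2)[of "\<gamma> t" v "\<gamma> s"] show ?thesis by (simp add: mult.assoc)
  qed
  show ?thesis
  proof (intro allI impI)
    fix \<epsilon> :: real assume \<epsilon>: "0 < \<epsilon>"
    \<comment> \<open>Steering is asked for this squared accuracy because it measures squared
      overlap, while the distance is the square root of the missing part.\<close>
    then have "0 < \<epsilon>\<^sup>2" by simp
    moreover have "\<gamma> s \<in> K" if "s \<in> {0..1}" for s using \<gamma>(2) that by blast
    ultimately obtain T u \<psi> where st: "steering hbar ?H K T u \<psi>" "0 < T" "\<psi> 0 = ket (\<lambda>_. False)"
      "norm (\<psi> T) = 1" "1 - \<epsilon>\<^sup>2 \<le> (cmod (braket (ket x1) (\<psi> T)))\<^sup>2"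
      using steering_along_gapped_curve[where H = ?H and \<gamma> = \<gamma>,
          OF pos(2) g _ _ hermitian_hamiltonian gs lip]
        \<open>p 0 = ket x0\<close> \<open>p 1 = ket x1\<close> x0_eq by metis
    have u: "u \<in> borel_measurable borel" "\<And>t. u t \<in> K" using st(1) unfolding steering_def by auto
    have sol: "schroedinger_solution hbar C\<^sub>6 r T u \<psi>"
      using steering_imp_schroedinger_solution[OF _ st(1,3)] pos(2) by simp
    have "bounded K" unfolding K_def by (intro bounded_Times) auto
    then obtain B where "\<And>c. c \<in> K \<Longrightarrow> norm c \<le> B" unfolding bounded_iff by blast
    then have "AE t in lebesgue_on {0<..<T}. norm (u t) \<le> B" using u(2) by (intro AE_I2) blast
    moreover have "u \<in> borel_measurable (lebesgue_on {0<..<T})"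
      using u(1) by (intro measurable_restrict_space1) (rule measurable_completion, simp)
    ultimately have "L_infinity {0<..<T} u" unfolding L_infinity_def by blast
    moreover have "infdist (\<phi> T) (H_MIS E) \<le> \<epsilon> \<and>
        1 - \<epsilon>\<^sup>2 \<le> (\<Sum>x\<in>MIS E. (cmod (braket (ket x) (\<phi> T)))\<^sup>2)"
      if "schroedinger_solution hbar C\<^sub>6 r T u \<phi>" for \<phi>
    proof -
      have "\<phi> T = \<psi> T"
        using pos(2) st(2) by (intro schroedinger_solution_unique[OF _ _ hermitian_hamiltonian that sol]) auto
      then show ?thesis using overlap_MIS[OF x1_MIS st(4) _ st(5)] \<epsilon> by simp
    qed
    moreover have "fst (u t) \<in> {0..\<Omega>\<^sub>m\<^sub>a\<^sub>x} \<and> snd (u t) \<in> {-\<delta>\<^sub>m\<^sub>a\<^sub>x..\<delta>\<^sub>m\<^sub>a\<^sub>x}" for t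
      using u(2)[of t] unfolding K_def mem_Times_iff .
    ultimately show "\<exists>T>0. \<exists>\<Omega> \<delta> :: real \<Rightarrow> real.
      L_infinity {0<..<T} (\<lambda>t. (\<Omega> t, \<delta> t)) \<and>
      (AE t in lebesgue_on {0<..<T}. \<Omega> t \<in> {0..\<Omega>\<^sub>m\<^sub>a\<^sub>x} \<and> \<delta> t \<in> {-\<delta>\<^sub>m\<^sub>a\<^sub>x..\<delta>\<^sub>m\<^sub>a\<^sub>x}) \<and>
      (\<exists>\<psi>. schroedinger_solution hbar C\<^sub>6 r T (\<lambda>t. (\<Omega> t, \<delta> t)) \<psi>) \<and>
      (\<forall>\<psi>. schroedinger_solution hbar C\<^sub>6 r T (\<lambda>t. (\<Omega> t, \<delta> t)) \<psi> \<longrightarrow>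
        infdist (\<psi> T) (H_MIS E) \<le> \<epsilon> \<and>
        (\<Sum>x\<in>MIS E. (cmod (braket (ket x) (\<psi> T)))\<^sup>2) \<ge> 1 - \<epsilon>\<^sup>2)"
      using st(2) sol
      by (intro exI[of _ T] conjI exI[of _ "\<lambda>t. fst (u t)"] exI[of _ "\<lambda>t. snd (u t)"] AE_I2) auto
  qed
qed

end
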